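(* Let $n\ge 2$, let $P$ be a doubly stochastic matrix and let $(X_k)_{k\ge0}$ be the random walk $\mathbf{RW}(S_n,P)$ on the symmetric group $S_n$. Then $$\lim_{N\to\infty}\mathbb{E}\big[c(\overline{\widetilde X_{2N}})\big]=H_n+\frac{(-1)^n}{n(n-1)},\qquad \lim_{N\to\infty}\mathbb{E}\big[c(\overline{\widetilde X_{2N+1}})\big]=H_n-\frac{(-1)^n}{n(n-1)},$$ where $c(L)$ denotes the number of connected components of a link $L$ and $H_n=\sum_{i=1}^n\frac1i$.
   Context: The symmetric group $S_n$ is viewed as the Coxeter group of type $A_{n-1}$, with generators the adjacent transpositions $s_i=(i\ \, i+1)$, $1\le i\le n-1$. The braid group $Br_n$ on $n$ strands is the group with generators $\sigma_1,\ldots,\sigma_{n-1}$ and relations $\sigma_i\sigma_j=\sigma_j\sigma_i$ for $|i-j|>1$ and $\sigma_i\sigma_{i+1}\sigma_i=\sigma_{i+1}\sigma_i\sigma_{i+1}$ for $1\le i\le n-2$. Geometrically, $\sigma_i$ is the braid with a single crossing between strands in positions $i$ and $i+1$, and the product is concatenation of braids. The lift $w\mapsto\widetilde w$ from $S_n$ to $Br_n$ is defined by $\widetilde w=\sigma_{i_1}\cdots\sigma_{i_r}$ whenever $w=s_{i_1}\cdots s_{i_r}$ is a reduced expression (one with the minimal number of factors). It is well defined by Matsumoto's theorem. For a braid $\beta$, $\overline\beta$ denotes its closure, the link obtained by connecting the opposite endpoints of the braid (the $i$-th top endpoint with the $i$-th bottom endpoint for each $i$). The random walk $\mathbf{RW}(S_n,P)$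 is a (time-homogeneous) Markov chain $X_0,X_1,\ldots$ with state space $S_n$, with $X_0=1$ (the identity) almost surely, and with transition matrix $P=(p_{ab})_{a,b\in S_n}$ such that $p_{ab}>0$ if and only if $b=as_i$ for some $i$. A matrix is doubly stochastic if its entries are nonnegative and all its row sums and column sums equal $1$. *)

theory Defs
  imports
    "HOL-Algebra.Sym_Groups"
    "HOL-Probability.Probability"
begin

section \<open>The symmetric group as a Coxeter group\<close>

text \<open>
  The library constant \<open>sym_group n\<close> is the group of permutations of \<open>{1..n}\<close> under composition.
  The generators \<open>s\<^sub>1, \<dots>, s\<^sub>n\<^sub>-\<^sub>1\<close> are indexed by \<open>{1..<n}\<close>. The name has to be qualified because
  \<open>transpose\<close> also denotes matrix transposition.
\<close>

definition adj_transp :: "nat \<Rightarrow> nat \<Rightarrow> nat" where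
  "adj_transp i = Transposition.transpose i (Suc i)"

definition perm_of_word :: "nat \<Rightarrow> nat list \<Rightarrow> (nat \<Rightarrow> nat)" where
  "perm_of_word n is =
     foldr (mult (sym_group n)) (map adj_transp is) (one (sym_group n))"

definition reduced_expression :: "nat \<Rightarrow> (nat \<Rightarrow> nat) \<Rightarrow> nat list \<Rightarrow> bool" where
  "reduced_expression n w is \<longleftrightarrow>
     is_arg_min length (\<lambda>js. js \<in> lists {1..<n} \<and> perm_of_word n js = w) is"


section \<open>The braid group\<close>

text \<open>
  The letters \<open>(i, True)\<close> and \<open>(i, False)\<close> stand for \<open>\<sigma>\<^sub>i\<close> and its inverse. Since the library has no
  group presentations, the group is built directly as the quotient of the words by the congruence
  that the defining relations and free cancellation generate.
\<close>

type_synonym braid_word = "(nat \<times> bool) list"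

definition braid_words :: "nat \<Rightarrow> braid_word set" where
  "braid_words n = lists ({1..<n} \<times> UNIV)"

inductive_set braid_rel :: "nat \<Rightarrow> (braid_word \<times> braid_word) set" for n :: nat where
  refl: "u \<in> braid_words n \<Longrightarrow> (u, u) \<in> braid_rel n"
| sym: "(u, v) \<in> braid_rel n \<Longrightarrow> (v, u) \<in> braid_rel n"
| trans: "(u, v) \<in> braid_rel n \<Longrightarrow> (v, w) \<in> braid_rel n \<Longrightarrow> (u, w) \<in> braid_rel n"
| cong: "(u, u') \<in> braid_rel n \<Longrightarrow> (v, v') \<in> braid_rel n \<Longrightarrow> (u @ v, u' @ v') \<in> braid_rel n"
| cancel: "i \<in> {1..<n} \<Longrightarrow> ([(i, e), (i, \<not> e)], []) \<in> braid_rel n"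
| commute: "i \<in> {1..<n} \<Longrightarrow> j \<in> {1..<n} \<Longrightarrow> \<bar>int i - int j\<bar> > 1 \<Longrightarrow>
    ([(i, True), (j, True)], [(j, True), (i, True)]) \<in> braid_rel n"
| braid: "i \<in> {1..<n} \<Longrightarrow> Suc i \<in> {1..<n} \<Longrightarrow>
    ([(i, True), (Suc i, True), (i, True)], [(Suc i, True), (i, True), (Suc i, True)])
      \<in> braid_rel n"

definition braid_group :: "nat \<Rightarrow> braid_word set monoid" where
  "braid_group n =
     \<lparr> carrier = braid_words n // braid_rel n,
       mult = (\<lambda>\<alpha> \<beta>. \<Union>u\<in>\<alpha>. \<Union>v\<in>\<beta>. braid_rel n `` {u @ v}),
       one = braid_rel n `` {[]} \<rparr>"

definition braid_gen :: "nat \<Rightarrow> nat \<Rightarrow> braid_word set" where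
  "braid_gen n i = braid_rel n `` {[(i, True)]}"

lemma braid_rel_words: "(u, v) \<in> braid_rel n \<Longrightarrow> u \<in> braid_words n \<and> v \<in> braid_words n"
  by (induction rule: braid_rel.induct) (auto simp: braid_words_def)

lemma equiv_braid_rel: "equiv (braid_words n) (braid_rel n)"
proof (rule equivI)
  show "braid_rel n \<subseteq> braid_words n \<times> braid_words n" using braid_rel_words by auto
  show "refl_on (braid_words n) (braid_rel n)"
    by (auto simp: refl_on_def intro: braid_rel.refl)
  show "Relation.sym (braid_rel n)" by (auto simp: sym_def intro: braid_rel.sym)
  show "Relation.trans (braid_rel n)" by (auto simp: trans_def intro: braid_rel.trans)
qed

lemma braid_group_mult_class:
  assumes "u \<in> braid_words n" "v \<in> braid_words n"
  shows "mult (braid_group n) (braid_rel n `` {u}) (braid_rel n `` {v}) = braid_rel n `` {u @ v}"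
proof -
  have "congruent2 (braid_rel n) (braid_rel n) (\<lambda>u v. braid_rel n `` {u @ v})"
    by (auto simp: congruent2_def intro!: equiv_class_eq[OF equiv_braid_rel] braid_rel.cong)
  from UN_equiv_class2[OF equiv_braid_rel equiv_braid_rel this assms]
  show ?thesis by (simp add: braid_group_def)
qed

lemma group_braid_group: "group (braid_group n)"
proof -
  let ?G = "braid_group n"
  let ?c = "\<lambda>u. braid_rel n `` {u}"
  have carr: "x \<in> carrier ?G \<longleftrightarrow> (\<exists>u\<in>braid_words n. x = ?c u)" for x
    by (auto simp: braid_group_def quotient_def)
  have one: "one ?G = ?c []" by (simp add: braid_group_def)
  have nil: "[] \<in> braid_words n" by (simp add: braid_words_def)
  have app: "u @ v \<in> braid_words n" if "u \<in> braid_words n" "v \<in> braid_words n" for u v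
    using that by (auto simp: braid_words_def)
  have inv: "\<exists>v\<in>braid_words n. (v @ u, []) \<in> braid_rel n" if "u \<in> braid_words n" for u
    using that
  proof (induction u)
    case Nil
    then show ?case using nil braid_rel.refl by force
  next
    case (Cons a u)
    obtain i e where a: "a = (i, e)" by (cases a)
    have i: "i \<in> {1..<n}" and u: "u \<in> braid_words n"
      using Cons.prems by (auto simp: braid_words_def a)
    obtain v where v: "v \<in> braid_words n" "(v @ u, []) \<in> braid_rel n"
      using Cons.IH[OF u] by blast
    have "([(i, \<not> e), (i, e)], []) \<in> braid_rel n"
      using braid_rel.cancel[OF i, of "\<not> e"] by simp
    from braid_rel.cong[OF braid_rel.refl[OF v(1)] braid_rel.cong[OF this braid_rel.refl[OF u]]]
    have "(v @ [(i, \<not> e)] @ a # u, v @ u) \<in> braid_rel n" by (simp add: a)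
    with v(2) have "((v @ [(i, \<not> e)]) @ a # u, []) \<in> braid_rel n"
      using braid_rel.trans by fastforce
    moreover have "v @ [(i, \<not> e)] \<in> braid_words n"
      using v(1) i by (auto simp: braid_words_def)
    ultimately show ?case by blast
  qed
  show ?thesis
  proof (rule groupI)
    fix x assume "x \<in> carrier ?G"
    then obtain u where u: "u \<in> braid_words n" "x = ?c u" using carr by auto
    obtain v where v: "v \<in> braid_words n" "(v @ u, []) \<in> braid_rel n"
      using inv[OF u(1)] by blast
    have "mult ?G (?c v) x = one ?G"
      using equiv_class_eq[OF equiv_braid_rel v(2)] u v by (simp add: braid_group_mult_class one)
    then show "\<exists>y\<in>carrier ?G. mult ?G y x = one ?G" using carr v(1) by auto
  qed (auto simp: carr one braid_group_mult_class nil app)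
qed

text \<open>
  By Matsumoto's theorem the value does not depend on the reduced expression that is chosen.
\<close>

definition braid_lift :: "nat \<Rightarrow> (nat \<Rightarrow> nat) \<Rightarrow> braid_word set" where
  "braid_lift n w =
     foldr (mult (braid_group n))
       (map (braid_gen n) (SOME is. reduced_expression n w is))
       (one (braid_group n))"


section \<open>Braid closures\<close>

text \<open>
  A point of three-space is a triple \<open>(x, y, z)\<close>; \<open>x\<close> is the strand position, \<open>y\<close> the depth and \<open>z\<close>
  the height. The strand of the letter \<open>(i, e)\<close> that starts in position \<open>j\<close> at height \<open>k\<close> ends at
  height \<open>k + 1\<close>. It is vertical unless \<open>j = i\<close> or \<open>j = i + 1\<close>; these two strands exchange their
  positions and pass each other at depths \<open>1\<close> and \<open>-1\<close>, so that the sign \<open>e\<close> decides which of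
  them is in front.
\<close>

type_synonym point3 = "real \<times> real \<times> real"

definition strand :: "nat \<Rightarrow> nat \<times> bool \<Rightarrow> nat \<Rightarrow> point3 set" where
  "strand k l j =
     (let (i, e) = l; x = real j; z = real k; d = (if e then 1 else -1) in
      if j = i then
        closed_segment (x, 0, z) (x + 1/2, d, z + 1/2) \<union>
        closed_segment (x + 1/2, d, z + 1/2) (x + 1, 0, z + 1)
      else if j = Suc i then
        closed_segment (x, 0, z) (x - 1/2, -d, z + 1/2) \<union>
        closed_segment (x - 1/2, -d, z + 1/2) (x - 1, 0, z + 1)
      else closed_segment (x, 0, z) (x, 0, z + 1))"

text \<open>
  Concatenation of words stacks the braids. The \<open>i\<close>-th top endpoint is \<open>(i, 0, m)\<close> and the \<open>i\<close>-th
  bottom endpoint is \<open>(i, 0, 0)\<close>, with \<open>m\<close> the length of the word.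
\<close>

definition geometric_braid :: "nat \<Rightarrow> braid_word \<Rightarrow> point3 set" where
  "geometric_braid n u = (\<Union>k\<in>{..<length u}. \<Union>j\<in>{1..n}. strand k (u ! k) j)"

text \<open>
  The closing arcs are nested rectangular arcs to the right of the braid, all of them in the plane
  \<open>y = 0\<close>: the \<open>i\<close>-th one climbs by \<open>n + 1 - i\<close>, turns right to \<open>x = 2 * n + 1 - i\<close>, goes down there
  and returns to the \<open>i\<close>-th bottom endpoint symmetrically.
\<close>

definition closing_arc :: "nat \<Rightarrow> nat \<Rightarrow> nat \<Rightarrow> point3 set" where
  "closing_arc n m i =
     (let x = real i; h = real n + 1 - real i; x' = real n + h; t = real m + h in
      closed_segment (x, 0, real m) (x, 0, t) \<union>
      closed_segment (x, 0, t) (x', 0, t) \<union>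
      closed_segment (x', 0, t) (x', 0, - h) \<union>
      closed_segment (x', 0, - h) (x, 0, - h) \<union>
      closed_segment (x, 0, - h) (x, 0, 0))"

definition word_closure :: "nat \<Rightarrow> braid_word \<Rightarrow> point3 set" where
  "word_closure n u = geometric_braid n u \<union> (\<Union>i\<in>{1..n}. closing_arc n (length u) i)"

text \<open>
  The closure of a braid is a link up to isotopy: words that represent the same braid have isotopic
  closures, and one of them is chosen here.
\<close>

definition braid_closure :: "nat \<Rightarrow> braid_word set \<Rightarrow> point3 set" where
  "braid_closure n \<beta> = word_closure n (SOME u. u \<in> \<beta>)"

definition num_components :: "point3 set \<Rightarrow> nat" where
  "num_components L = card (components L)"


section \<open>Random walks on the symmetric group\<close>

definition stochastic_on :: "'s set \<Rightarrow> ('s \<Rightarrow> 's \<Rightarrow> real) \<Rightarrow> bool" where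
  "stochastic_on S P \<longleftrightarrow>
     (\<forall>a\<in>S. \<forall>b\<in>S. 0 \<le> P a b) \<and> (\<forall>a\<in>S. (\<Sum>b\<in>S. P a b) = 1)"

definition doubly_stochastic_on :: "'s set \<Rightarrow> ('s \<Rightarrow> 's \<Rightarrow> real) \<Rightarrow> bool" where
  "doubly_stochastic_on S P \<longleftrightarrow>
     (\<forall>a\<in>S. \<forall>b\<in>S. 0 \<le> P a b) \<and>
     (\<forall>a\<in>S. (\<Sum>b\<in>S. P a b) = 1) \<and> (\<forall>b\<in>S. (\<Sum>a\<in>S. P a b) = 1)"

text \<open>
  The condition on \<open>x\<close> is the Markov property and time homogeneity at once: whatever the history
  \<open>x 0, \<dots>, x k\<close> of positive probability, the next state is distributed according to row \<open>x k\<close>.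
\<close>

definition markov_chain ::
  "'a measure \<Rightarrow> 's set \<Rightarrow> ('s \<Rightarrow> 's \<Rightarrow> real) \<Rightarrow> (nat \<Rightarrow> 'a \<Rightarrow> 's) \<Rightarrow> bool" where
  "markov_chain M S P X \<longleftrightarrow>
     prob_space M \<and> stochastic_on S P \<and>
     (\<forall>k. X k \<in> measurable M (count_space S)) \<and>
     (\<forall>k x. \<forall>b\<in>S. \<P>(\<omega> in M. \<forall>j\<le>k. X j \<omega> = x j) > 0 \<longrightarrow>
        \<P>(\<omega> in M. X (Suc k) \<omega> = b \<bar> \<forall>j\<le>k. X j \<omega> = x j) = P (x k) b)"

definition random_walk ::
  "'a measure \<Rightarrow> nat \<Rightarrow> ((nat \<Rightarrow> nat) \<Rightarrow> (nat \<Rightarrow> nat) \<Rightarrow> real) \<Rightarrow>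
     (nat \<Rightarrow> 'a \<Rightarrow> (nat \<Rightarrow> nat)) \<Rightarrow> bool" where
  "random_walk M n P X \<longleftrightarrow>
     markov_chain M (carrier (sym_group n)) P X \<and>
     (AE \<omega> in M. X 0 \<omega> = one (sym_group n)) \<and>
     (\<forall>a\<in>carrier (sym_group n). \<forall>b\<in>carrier (sym_group n).
        P a b > 0 \<longleftrightarrow> (\<exists>i\<in>{1..<n}. b = mult (sym_group n) a (adj_transp i)))"

end

theory Submission
  imports Defs "HOL-Combinatorics.Orbits"
begin

text \<open>
  The number of components of the closure of a braid only depends on its underlying permutation:
  a strand starting in position \<open>a\<close> runs up the braid and comes back, through a closing arc, to the
  position that the permutation (or its inverse) assigns to \<open>a\<close>. So the components are the cycles
  of the permutation (\<open>num_components_word_closure\<close>). Braid relations do not change the underlying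
  permutation, and the lift of \<open>w\<close> has the underlying permutation \<open>w\<close>; hence the random variable in
  question is the number of cycles of \<open>X\<^sub>k\<close> (\<open>num_components_closure_lift\<close>).

  Every step of the walk multiplies by an adjacent transposition and so changes the sign. Two steps
  form a chain on the alternating group. It is irreducible because the adjacent transpositions
  generate \<open>S\<^sub>n\<close>, and it can stay in place because a transposition can be undone. As \<open>P\<close> has column
  sums \<open>1\<close>, the distribution after a step consists of weighted averages of the values of the
  distribution before it; with irreducibility and a positive chance to stay, repeated averaging
  flattens every function (\<open>irreducible_averaging_converges\<close>). Thus \<open>X\<^sub>2\<^sub>N\<close>
  becomes equidistributed on the even and \<open>X\<^sub>2\<^sub>N\<^sub>+\<^sub>1\<close> on the odd permutations: the probability of \<open>w\<close> tends to \<open>(1 \<plusminus> sign w) / n!\<close>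
  (\<open>random_walk_limit_distribution\<close>).

  What remains is to sum \<open>(1 \<plusminus> sign w) / n!\<close> times the number of cycles of \<open>w\<close> over all \<open>w\<close>. Building
  a permutation of \<open>n + 1\<close> points from one of \<open>n\<close> points, the new point either is fixed, which adds a
  cycle, or is inserted into an existing cycle in one of \<open>n\<close> ways, which keeps the number of
  cycles and flips the sign. This gives recursions with the solutions \<open>n! H\<^sub>n\<close> for the plain sum
  (\<open>sum_num_cycles\<close>) and \<open>(-1)\<^sup>n (n - 2)!\<close> for the sum with signs (\<open>sum_sign_num_cycles\<close>).
\<close>

section \<open>Cycles of permutations\<close>

text \<open>
  Fixed points in \<open>A\<close> count as cycles. The set \<open>A\<close> is a parameter because the points outside the
  permuted set, which are fixed as well, must not be counted.
\<close>

definition num_cycles :: "'a set \<Rightarrow> ('a \<Rightarrow> 'a) \<Rightarrow> nat" where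
  "num_cycles A p = card (orbit p ` A)"

lemma permutes_in_orbit_self:
  assumes "finite A" "p permutes A"
  shows "x \<in> orbit p x"
proof (rule permutation_self_in_orbit)
  show "permutation p" using assms by (auto simp: permutation_permutes)
qed

lemma permutes_orbit_eq:
  assumes "finite A" "p permutes A" "y \<in> orbit p x"
  shows "orbit p y = orbit p x"
proof -
  have "x \<in> orbit p y"
    using orbit_swap[OF permutes_in_orbit_self[OF assms(1,2)] assms(3)] .
  then show ?thesis using assms(3) by (blast intro: orbit_trans)
qed

lemma num_cycles_insert_fixpoint:
  assumes "finite A" "a \<notin> A" "p permutes A"
  shows "num_cycles (insert a A) p = num_cycles A p + 1"
proof -
  have "orbit p a = {a}"
    using assms by (simp add: orbit_eq_singleton_iff permutes_not_in)
  moreover have "{a} \<notin> orbit p ` A"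
    using assms permutes_orbit_subset[OF assms(3)] by blast
  ultimately show ?thesis using assms(1) by (simp add: num_cycles_def)
qed

text \<open>
  With \<open>q = (a b) p\<close>, the element that \<open>p\<close> sends to \<open>b\<close> now goes to \<open>a\<close>, and \<open>a\<close> goes to \<open>b\<close>: the new point
  is spliced into the cycle of \<open>b\<close> just before \<open>b\<close>. Hence deleting \<open>a\<close> turns the orbits of \<open>q\<close> into
  those of \<open>p\<close>, and it does so injectively because every orbit contains a point other than \<open>a\<close>.
\<close>

lemma num_cycles_insert_into_cycle:
  assumes "finite A" "a \<notin> A" "b \<in> A" "p permutes A"
  shows "num_cycles (insert a A) (Transposition.transpose a b \<circ> p) = num_cycles A p"
proof -
  define q where "q = Transposition.transpose a b \<circ> p"
  have pa: "p a = a" using assms by (simp add: permutes_not_in)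
  have p_ne: "p x \<noteq> a" if "x \<noteq> a" for x
    using that pa inj_eq[OF permutes_inj[OF assms(4)], of x a] by simp
  have q: "q a = b" "q x = (if p x = b then a else p x)" if "x \<noteq> a" for x
    using pa p_ne[OF that] by (auto simp: q_def Transposition.transpose_def)
  have qa: "q a = b" using pa by (simp add: q_def)
  have q_perm: "q permutes insert a A"
    unfolding q_def using assms
    by (intro permutes_compose permutes_swap_id) (auto intro: permutes_subset)
  note fin = finite.insertI[OF assms(1), of a]
  have in_q: "y \<in> orbit q x" if "y \<in> orbit p x" "x \<noteq> a" for x y
  proof -
    have step: "p z \<in> orbit q x" if "z \<in> orbit q x" "z \<noteq> a" for z
    proof (cases "p z = b")
      case True
      then have "a \<in> orbit q x" using orbit.step[OF that(1)] q(2)[OF that(2)] by simp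
      from orbit.step[OF this] show ?thesis by (simp add: qa True)
    next
      case False
      then show ?thesis using orbit.step[OF that(1)] q(2)[OF that(2)] by simp
    qed
    from that(1) have "y \<in> orbit q x \<and> y \<noteq> a"
    proof (induction rule: orbit.induct)
      case base
      show ?case using step[OF permutes_in_orbit_self[OF fin q_perm] that(2)] p_ne[OF that(2)]
        by simp
    next
      case (step y)
      then show ?case using \<open>\<And>z. z \<in> orbit q x \<Longrightarrow> z \<noteq> a \<Longrightarrow> p z \<in> orbit q x\<close> p_ne by blast
    qed
    then show ?thesis by simp
  qed
  have in_p: "if y = a then b \<in> orbit p x else y \<in> orbit p x"
    if "y \<in> orbit q x" "x \<noteq> a" for x y
    using that(1)
  proof (induction rule: orbit.induct)
    case base
    then show ?case using q(2)[OF that(2)] p_ne[OF that(2)] orbit.base[of p x] by auto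
  next
    case (step y)
    show ?case
    proof (cases "y = a")
      case True
      then show ?thesis using step.IH qa assms by (auto split: if_splits)
    next
      case False
      then show ?thesis
        using step.IH q(2)[OF False] p_ne[OF False] orbit.step[of y p x] by (auto split: if_splits)
    qed
  qed
  have orb: "orbit q x - {a} = orbit p x" if "x \<in> A" for x
  proof -
    have "x \<noteq> a" using that assms by auto
    moreover have "a \<notin> orbit p x" using permutes_orbit_subset[OF assms(4) that] assms by auto
    moreover have "y \<in> orbit p x" if "y \<in> orbit q x" "y \<noteq> a" for y
      using in_p[OF that(1) \<open>x \<noteq> a\<close>] that(2) by simp
    ultimately show ?thesis using in_q[of _ x] by auto
  qed
  have "orbit q a = orbit q b"
    using permutes_orbit_eq[OF fin q_perm, of b a] orbit.base[of q a] by (simp add: qa)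
  then have "orbit q ` insert a A = orbit q ` A" using assms(3) by auto
  moreover have "inj_on (\<lambda>C. C - {a}) (orbit q ` A)"
  proof (rule inj_onI, elim imageE)
    fix C1 C2 x y
    assume *: "C1 - {a} = C2 - {a}" "C1 = orbit q x" "C2 = orbit q y" "x \<in> A" "y \<in> A"
    then have "orbit p x = orbit p y" using orb by simp
    then have "x \<in> orbit q y"
      using permutes_in_orbit_self[OF assms(1,4), of x] in_q[of x y] * assms(2) by auto
    then show "C1 = C2" using permutes_orbit_eq[OF fin q_perm] * by simp
  qed
  moreover have "(\<lambda>C. C - {a}) ` orbit q ` A = orbit p ` A"
    using orb by (auto simp: image_image cong: image_cong)
  ultimately show ?thesis
    unfolding num_cycles_def q_def[symmetric] by (metis card_image)
qed

text \<open>
  The recursion is \<open>T\<^sub>m\<^sub>+\<^sub>1 = (T\<^sub>m + m!) + m T\<^sub>m\<close>: the summand in brackets comes from the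
  permutations that fix the new point, the other one from those that insert it into a cycle.
\<close>

lemma sum_num_cycles:
  assumes "finite A"
  shows "(\<Sum>p | p permutes A. real (num_cycles A p)) = fact (card A) * harm (card A)"
  using assms
proof (induction A)
  case empty
  then show ?case by (simp add: num_cycles_def harm_expand)
next
  case (insert a A)
  let ?S = "{p. p permutes A}"
  have "(\<Sum>p | p permutes (insert a A). real (num_cycles (insert a A) p))
      = (\<Sum>b\<in>insert a A. \<Sum>q\<in>?S. real (num_cycles (insert a A) (Transposition.transpose a b \<circ> q)))"
    using insert.hyps by (rule sum_over_permutations_insert)
  also have "\<dots> = (\<Sum>q\<in>?S. 1 + real (num_cycles A q))
      + (\<Sum>b\<in>A. \<Sum>q\<in>?S. real (num_cycles A q))"
    using insert.hyps
    by (simp add: num_cycles_insert_fixpoint num_cycles_insert_into_cycle)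
  also have "\<dots> = fact (card (insert a A)) * harm (card (insert a A))"
    using insert by (simp add: sum.distrib card_permutations harm_Suc field_simps)
  finally show ?case .
qed

lemma sum_sign_permutations:
  assumes "finite A"
  shows "(\<Sum>p | p permutes A. real_of_int (sign p)) = (if card A \<le> 1 then 1 else 0)"
  using assms
proof (induction A)
  case empty
  then show ?case by simp
next
  case (insert a A)
  let ?S = "{p. p permutes A}"
  have sgn: "sign (Transposition.transpose a b \<circ> q) = - sign q" if "b \<in> A" "q permutes A" for b q
    using that insert.hyps
    by (subst sign_compose) (auto simp: sign_swap_id permutation_swap_id permutation_permutes[of q])
  have "(\<Sum>p | p permutes (insert a A). real_of_int (sign p))
      = (\<Sum>b\<in>insert a A. \<Sum>q\<in>?S. real_of_int (sign (Transposition.transpose a b \<circ> q)))"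
    using insert.hyps by (rule sum_over_permutations_insert)
  also have "\<dots> = (\<Sum>q\<in>?S. real_of_int (sign q)) + (\<Sum>b\<in>A. \<Sum>q\<in>?S. - real_of_int (sign q))"
    unfolding sum.insert[OF insert.hyps]
    by (intro arg_cong2[of _ _ _ _ "(+)"] sum.cong) (simp_all add: sgn)
  also have "\<dots> = (if card (insert a A) \<le> 1 then 1 else 0)"
    using insert by (auto simp: sum_negf le_Suc_eq)
  finally show ?case .
qed

text \<open>
  Inserting the new point into a cycle multiplies by a transposition, so the recursion for the sum
  \<open>U\<^sub>m\<close> with signs is \<open>U\<^sub>m\<^sub>+\<^sub>1 = (1 - m) U\<^sub>m + e\<^sub>m\<close>, where \<open>e\<^sub>m\<close> is the sum of all signs. It starts with
  \<open>U\<^sub>2 = 1\<close>, and \<open>e\<^sub>m\<close> vanishes from then on.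
\<close>

lemma sum_sign_num_cycles:
  assumes "finite A" "card A = Suc (Suc k)"
  shows "(\<Sum>p | p permutes A. real_of_int (sign p) * real (num_cycles A p)) = (-1) ^ k * fact k"
proof -
  have rec: "(\<Sum>p | p permutes insert a B. real_of_int (sign p) * real (num_cycles (insert a B) p))
      = (1 - real (card B)) * (\<Sum>p | p permutes B. real_of_int (sign p) * real (num_cycles B p))
        + (if card B \<le> 1 then 1 else 0)"
    if "finite B" "a \<notin> B" for a :: 'a and B
  proof -
    let ?S = "{p. p permutes B}"
    have sgn: "sign (Transposition.transpose a b \<circ> q) = - sign q" if "b \<in> B" "q permutes B" for b q
      using that \<open>finite B\<close> \<open>a \<notin> B\<close>
      by (subst sign_compose) (auto simp: sign_swap_id permutation_swap_id permutation_permutes[of q])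
    have "(\<Sum>p | p permutes insert a B. real_of_int (sign p) * real (num_cycles (insert a B) p))
      = (\<Sum>b\<in>insert a B. \<Sum>q\<in>?S. real_of_int (sign (Transposition.transpose a b \<circ> q))
           * real (num_cycles (insert a B) (Transposition.transpose a b \<circ> q)))"
      using that by (rule sum_over_permutations_insert)
    also have "\<dots> = (\<Sum>q\<in>?S. real_of_int (sign q) * (1 + real (num_cycles B q)))
      + (\<Sum>b\<in>B. \<Sum>q\<in>?S. - (real_of_int (sign q) * real (num_cycles B q)))"
      unfolding sum.insert[OF that]
      by (intro arg_cong2[of _ _ _ _ "(+)"] sum.cong)
        (simp_all add: sgn that num_cycles_insert_fixpoint num_cycles_insert_into_cycle)
    finally show ?thesis
      using sum_sign_permutations[OF that(1)]
      by (simp add: sum_negf sum.distrib algebra_simps)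
  qed
  show ?thesis using assms
  proof (induction k arbitrary: A)
    case 0
    then obtain a B where "A = insert a B" "a \<notin> B" "card B = 1" "finite B"
      by (metis card_Suc_eq finite_insert One_nat_def)
    then show ?case by (simp add: rec)
  next
    case (Suc k)
    then obtain a B where B: "A = insert a B" "a \<notin> B" "card B = Suc (Suc k)" "finite B"
      by (metis card_Suc_eq finite_insert)
    then show ?case using Suc.IH[of B] by (simp add: rec algebra_simps)
  qed
qed

text \<open>
  The weights are the two limit distributions of the walk: \<open>s = 1\<close> gives the mean over the even
  permutations and \<open>s = -1\<close> the mean over the odd ones.
\<close>

lemma mean_num_cycles_fixed_parity:
  assumes "n \<ge> 2"
  shows "(\<Sum>w | w permutes {1..n}. (1 + s * real_of_int (sign w)) / fact n * real (num_cycles {1..n} w))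
    = harm n + s * ((-1) ^ n / (real n * (real n - 1)))"
proof -
  obtain k where n: "n = Suc (Suc k)" using assms by (metis add_2_eq_Suc le_Suc_ex)
  let ?S = "{w. w permutes {1..n}}"
  have "(\<Sum>w\<in>?S. (1 + s * real_of_int (sign w)) / fact n * real (num_cycles {1..n} w))
    = ((\<Sum>w\<in>?S. real (num_cycles {1..n} w))
        + s * (\<Sum>w\<in>?S. real_of_int (sign w) * real (num_cycles {1..n} w))) / fact n"
    by (simp add: sum_distrib_left sum_divide_distrib sum.distrib[symmetric] add_divide_distrib
        algebra_simps)
  also have "\<dots> = (fact n * harm n + s * ((-1) ^ k * fact k)) / fact n"
    using sum_num_cycles[of "{1..n}"] sum_sign_num_cycles[of "{1..n}" k] n by simp
  also have "\<dots> = harm n + s * ((-1) ^ k * (fact k / fact n))"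
    by (simp add: add_divide_distrib)
  also have "fact k / fact n = 1 / (real n * (real n - 1))"
  proof -
    have "fact n = real n * (real n - 1) * fact k" unfolding n by (simp add: algebra_simps)
    then show ?thesis by simp
  qed
  also have "(-1 :: real) ^ k = (-1) ^ n" by (simp add: n)
  finally show ?thesis by simp
qed

section \<open>Components of the closure of a braid word\<close>

text \<open>
  Composition is ordered so that \<open>braid_perm u j\<close> is the bottom position of the strand that the word
  \<open>u\<close> brings to top position \<open>j\<close>. In particular, at height \<open>k\<close> the strand in position \<open>j\<close> started in
  position \<open>braid_perm (take k u) j\<close>, so inverse permutations are avoided.
\<close>

definition braid_perm :: "braid_word \<Rightarrow> nat \<Rightarrow> nat" where
  "braid_perm u = foldr (\<lambda>l p. adj_transp (fst l) \<circ> p) u id"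

lemma braid_perm_simps [simp]:
  "braid_perm [] = id"
  "braid_perm (l # u) = adj_transp (fst l) \<circ> braid_perm u"
  by (simp_all add: braid_perm_def)

lemma braid_perm_append [simp]: "braid_perm (u @ v) = braid_perm u \<circ> braid_perm v"
  by (induction u) (simp_all add: comp_assoc)

lemma adj_transp_permutes: "i \<in> {1..<n} \<Longrightarrow> adj_transp i permutes {1..n}"
  unfolding adj_transp_def by (rule permutes_swap_id) auto

lemma adj_transp_involutory [simp]: "adj_transp i (adj_transp i j) = j"
  by (simp add: adj_transp_def)

lemma braid_perm_permutes:
  assumes "u \<in> braid_words n"
  shows "braid_perm u permutes {1..n}"
  using assms
proof (induction u)
  case Nil
  show ?case unfolding braid_perm_simps by (rule permutes_id)
next
  case (Cons l u)
  then have "fst l \<in> {1..<n}" "braid_perm u permutes {1..n}" by (auto simp: braid_words_def)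
  then show ?case
    unfolding braid_perm_simps by (intro permutes_compose adj_transp_permutes)
qed

text \<open>
  A connected subset of the union that contains a member \<open>C\<close> is covered by two disjoint closed sets,
  \<open>C\<close> and the union of the finitely many other members; so it cannot leave \<open>C\<close>.
\<close>

lemma components_disjoint_closed_family:
  fixes F :: "'a::topological_space set set"
  assumes "finite F"
    and "\<And>C. C \<in> F \<Longrightarrow> closed C \<and> connected C \<and> C \<noteq> {}"
    and "\<And>C D. C \<in> F \<Longrightarrow> D \<in> F \<Longrightarrow> C \<noteq> D \<Longrightarrow> C \<inter> D = {}"
  shows "components (\<Union>F) = F"
proof -
  have sub: "C \<in> components (\<Union>F)" if "C \<in> F" for C
    unfolding in_components_maximal
  proof (intro conjI allI impI)
    fix D assume D: "D \<noteq> {} \<and> C \<subseteq> D \<and> D \<subseteq> \<Union>F \<and> connected D"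
    define R where "R = \<Union>(F - {C})"
    have cover: "D \<subseteq> C \<union> R" using D by (auto simp: R_def)
    have "closed R" unfolding R_def using assms by (intro closed_Union) auto
    moreover have "C \<inter> R \<inter> D = {}" unfolding R_def using assms(3)[OF that] by blast
    moreover note cover
    moreover have "connected D" "closed C" using D assms(2)[OF that] by simp_all
    ultimately have "C \<inter> D = {} \<or> R \<inter> D = {}" using connected_closedD by metis
    moreover have "C \<inter> D = C" "C \<noteq> {}" using D assms(2)[OF that] by auto
    ultimately have "R \<inter> D = {}" by simp
    then have "D \<subseteq> C" using cover by blast
    then show "D = C" using D by simp
  qed (use assms(2)[OF that] that in auto)
  moreover have "D \<in> F" if D: "D \<in> components (\<Union>F)" for D
  proof -
    obtain x where "x \<in> D" using in_components_nonempty[OF D] by blast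
    moreover from this obtain C where C: "x \<in> C" "C \<in> F"
      using in_components_subset[OF D] by blast
    ultimately have "D \<inter> C \<noteq> {}" by auto
    then have "D = C" using components_nonoverlap[OF D sub[OF C(2)]] by simp
    then show ?thesis using C(2) by simp
  qed
  ultimately show ?thesis by (intro subset_antisym subsetI)
qed

lemma in_closed_segment_triple:
  fixes a b c :: real
  assumes "(x, y, z) \<in> closed_segment (a, b, c) (a', b', c')"
  obtains s where "0 \<le> s" "s \<le> 1"
    "x = a + s * (a' - a)" "y = b + s * (b' - b)" "z = c + s * (c' - c)"
proof -
  obtain s where "0 \<le> s" "s \<le> 1" "(x, y, z) = (1 - s) *\<^sub>R (a, b, c) + s *\<^sub>R (a', b', c')"
    using assms unfolding closed_segment_def by blast
  then show ?thesis by (intro that[of s]) (simp_all add: algebra_simps)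
qed

text \<open>
  A strand is parametrised by the height \<open>t\<close> that it has gained. Its two halves are combined in
  one formula by the tent function \<open>1 - \<bar>2 * t - 1\<bar>\<close>, which is \<open>0\<close> at both ends and \<open>1\<close> at the
  crossing.
\<close>

lemma strand_coordinates:
  fixes e :: bool
  defines "d \<equiv> if e then 1 else -1 :: real"
  assumes "(x, y, z) \<in> strand k (i, e) j"
  shows "\<exists>t. 0 \<le> t \<and> t \<le> 1 \<and> z = real k + t \<and>
    (j = i \<and> x = real i + t \<and> y = d * (1 - \<bar>2 * t - 1\<bar>) \<or>
     j = Suc i \<and> x = real i + 1 - t \<and> y = - d * (1 - \<bar>2 * t - 1\<bar>) \<or>
     j \<noteq> i \<and> j \<noteq> Suc i \<and> x = real j \<and> y = 0)"
proof -
  consider (over) "j = i" | (under) "j = Suc i" | (off) "j \<noteq> i" "j \<noteq> Suc i" by blast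
  then show ?thesis
  proof cases
    case over
    then have "(x, y, z) \<in> closed_segment (real i, 0, real k) (real i + 1/2, d, real k + 1/2) \<or>
      (x, y, z) \<in> closed_segment (real i + 1/2, d, real k + 1/2) (real i + 1, 0, real k + 1)"
      using assms by (simp add: strand_def Let_def d_def)
    then show ?thesis
    proof
      assume "(x, y, z) \<in> closed_segment (real i, 0, real k) (real i + 1/2, d, real k + 1/2)"
      then obtain s where "0 \<le> s" "s \<le> 1" "x = real i + s / 2" "y = d * s" "z = real k + s / 2"
        by (rule in_closed_segment_triple) (simp add: algebra_simps)
      then show ?thesis using over by (intro exI[of _ "s / 2"]) simp
    next
      assume "(x, y, z) \<in> closed_segment (real i + 1/2, d, real k + 1/2) (real i + 1, 0, real k + 1)"
      then obtain s where "0 \<le> s" "s \<le> 1" "x = real i + (1 + s) / 2" "y = d * (1 - s)"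
          "z = real k + (1 + s) / 2"
        by (rule in_closed_segment_triple) (simp add: field_simps)
      then show ?thesis using over by (intro exI[of _ "(1 + s) / 2"]) (simp add: field_simps)
    qed
  next
    case under
    then have "(x, y, z) \<in> closed_segment (real i + 1, 0, real k) (real i + 1/2, - d, real k + 1/2) \<or>
      (x, y, z) \<in> closed_segment (real i + 1/2, - d, real k + 1/2) (real i, 0, real k + 1)"
      using assms by (simp add: strand_def Let_def d_def add.commute)
    then show ?thesis
    proof
      assume "(x, y, z) \<in> closed_segment (real i + 1, 0, real k) (real i + 1/2, - d, real k + 1/2)"
      then obtain s where "0 \<le> s" "s \<le> 1" "x = real i + 1 - s / 2" "y = - d * s" "z = real k + s / 2"
        by (rule in_closed_segment_triple) (simp add: algebra_simps)
      then show ?thesis using under by (intro exI[of _ "s / 2"]) simp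
    next
      assume "(x, y, z) \<in> closed_segment (real i + 1/2, - d, real k + 1/2) (real i, 0, real k + 1)"
      then obtain s where "0 \<le> s" "s \<le> 1" "x = real i + 1 - (1 + s) / 2" "y = - d * (1 - s)"
          "z = real k + (1 + s) / 2"
        by (rule in_closed_segment_triple) (simp add: field_simps)
      then show ?thesis using under by (intro exI[of _ "(1 + s) / 2"]) (simp add: field_simps)
    qed
  next
    case off
    then have "(x, y, z) \<in> closed_segment (real j, 0, real k) (real j, 0, real k + 1)"
      using assms by (simp add: strand_def Let_def)
    then obtain s where "0 \<le> s" "s \<le> 1" "x = real j" "y = 0" "z = real k + s"
      by (rule in_closed_segment_triple) simp
    then show ?thesis using off by blast
  qed
qed

text \<open>
  Two different strands could only meet at the same height. A vertical strand is separated from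
  the crossing by its \<open>x\<close> coordinate, and the two crossing strands have equal \<open>x\<close> only half way up,
  where their depths are opposite and nonzero.
\<close>

lemma strand_disjoint:
  assumes "p \<in> strand k l j" "p \<in> strand k l j'"
  shows "j = j'"
proof -
  obtain i e where l: "l = (i, e)" by (cases l)
  obtain x y z where p: "p = (x, y, z)" by (cases p)
  define d :: real where "d = (if e then 1 else -1)"
  obtain t where t: "z = real k + t" "0 \<le> t" "t \<le> 1" and
    pos: "j = i \<and> x = real i + t \<and> y = d * (1 - \<bar>2 * t - 1\<bar>) \<or>
     j = Suc i \<and> x = real i + 1 - t \<and> y = - d * (1 - \<bar>2 * t - 1\<bar>) \<or>
     j \<noteq> i \<and> j \<noteq> Suc i \<and> x = real j \<and> y = 0"
    using strand_coordinates[OF assms(1)[unfolded l p]] unfolding d_def by blast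
  obtain t' where t': "z = real k + t'" and
    pos': "j' = i \<and> x = real i + t' \<and> y = d * (1 - \<bar>2 * t' - 1\<bar>) \<or>
     j' = Suc i \<and> x = real i + 1 - t' \<and> y = - d * (1 - \<bar>2 * t' - 1\<bar>) \<or>
     j' \<noteq> i \<and> j' \<noteq> Suc i \<and> x = real j' \<and> y = 0"
    using strand_coordinates[OF assms(2)[unfolded l p]] unfolding d_def by blast
  have tt: "t' = t" using t(1) t' by simp
  have cross: False
    if "x = real i + t" "x = real i + 1 - t"
      "y = d * (1 - \<bar>2 * t - 1\<bar>)" "y = - d * (1 - \<bar>2 * t - 1\<bar>)"
  proof -
    have "t = 1 / 2" using that(1,2) by simp
    then show False using that(3,4) by (simp add: d_def split: if_splits)
  qed
  have off: "m = i \<or> m = Suc i" if "x = real m" "x = real i + t \<or> x = real i + 1 - t" for m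
  proof -
    have "real i \<le> real m" "real m \<le> real (Suc i)" using that t(2,3) by auto
    then have "i \<le> m" "m \<le> Suc i" by (simp_all only: of_nat_le_iff)
    then show ?thesis by linarith
  qed
  note pos' = pos'[unfolded tt]
  consider (off1) "x = real j" "j \<noteq> i" "j \<noteq> Suc i" | (off2) "x = real j'" "j' \<noteq> i" "j' \<noteq> Suc i"
    | (on) "j = i \<or> j = Suc i" "j' = i \<or> j' = Suc i"
    using pos pos' by argo
  then show ?thesis
  proof cases
    case off1
    then show ?thesis using off[OF off1(1)] pos' by auto
  next
    case off2
    then show ?thesis using off[OF off2(1)] pos by auto
  next
    case on
    show ?thesis
    proof (rule ccontr)
      assume "j \<noteq> j'"
      then have "j = i \<and> j' = Suc i \<or> j = Suc i \<and> j' = i" using on by auto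
      then show False using pos pos' cross by auto
    qed
  qed
qed

text \<open>
  These facts decide where pieces of a closed braid can touch. Strands of consecutive letters meet
  only at the integer height between them. The bound on \<open>x\<close> keeps the strands away from the sides of
  the closing arcs to the right of the braid, so that the two meet at most at the ends of the braid.
\<close>

lemma strand_range:
  assumes "(x, y, z) \<in> strand k l j"
  shows "real k \<le> z" "z \<le> real k + 1"
    and "z = real k \<Longrightarrow> x = real j \<and> y = 0"
    and "z = real k + 1 \<Longrightarrow> x = real (adj_transp (fst l) j) \<and> y = 0"
    and "fst l \<in> {1..<n} \<Longrightarrow> j \<in> {1..n} \<Longrightarrow> x \<le> real n"
proof -
  obtain i e where l: "l = (i, e)" by (cases l)
  define d :: real where "d = (if e then 1 else -1)"
  obtain t where t: "z = real k + t" "0 \<le> t" "t \<le> 1" and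
    pos: "j = i \<and> x = real i + t \<and> y = d * (1 - \<bar>2 * t - 1\<bar>) \<or>
     j = Suc i \<and> x = real i + 1 - t \<and> y = - d * (1 - \<bar>2 * t - 1\<bar>) \<or>
     j \<noteq> i \<and> j \<noteq> Suc i \<and> x = real j \<and> y = 0"
    using strand_coordinates[OF assms[unfolded l]] unfolding d_def by blast
  show "real k \<le> z" "z \<le> real k + 1" using t by auto
  show "x = real j \<and> y = 0" if "z = real k"
  proof -
    have t0: "t = 0" using that t(1) by simp
    from pos[unfolded t0] show ?thesis by (elim disjE conjE) simp_all
  qed
  show "x = real (adj_transp (fst l) j) \<and> y = 0" if "z = real k + 1"
  proof -
    have t1: "t = 1" using that t(1) by simp
    from pos[unfolded t1] show ?thesis
      by (elim disjE conjE) (simp_all add: l adj_transp_def)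
  qed
  show "x \<le> real n" if "fst l \<in> {1..<n}" "j \<in> {1..n}"
  proof -
    have "real i + 1 \<le> real n" "real j \<le> real n" using that by (auto simp: l)
    with pos t(2,3) show ?thesis by (elim disjE conjE) simp_all
  qed
qed

lemma strand_ends:
  "(real j, 0, real k) \<in> strand k l j"
  "(real (adj_transp (fst l) j), 0, real (Suc k)) \<in> strand k l j"
  by (auto simp: strand_def Let_def adj_transp_def Transposition.transpose_def add.commute
      split: prod.split)

lemma closed_strand: "closed (strand k l j)"
  by (auto simp: strand_def Let_def intro!: closed_Un split: prod.split)

lemma connected_strand: "connected (strand k l j)"
proof -
  obtain i e where l: "l = (i, e)" by (cases l)
  show ?thesis
    unfolding strand_def l Let_def prod.case
    by (auto intro!: connected_Un simp: disjoint_iff)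
qed

lemma closing_arc_coordinates:
  assumes "(x, y, z) \<in> closing_arc n m i" "i \<in> {1..n}"
  defines "h \<equiv> real n + 1 - real i"
  shows "x = real i \<and> real m \<le> z \<and> z \<le> real m + h \<or>
    z = real m + h \<and> real i \<le> x \<and> x \<le> real n + h \<or>
    x = real n + h \<and> - h \<le> z \<and> z \<le> real m + h \<or>
    z = - h \<and> real i \<le> x \<and> x \<le> real n + h \<or>
    x = real i \<and> - h \<le> z \<and> z \<le> 0"
proof -
  have h: "1 \<le> h" "real i \<le> real n" using assms(2) by (auto simp: h_def)
  have seg: "(x, y, z) \<in> closed_segment (a, 0, c) (a', 0, c') \<Longrightarrow>
     x \<in> closed_segment a a' \<and> z \<in> closed_segment c c'" for a c a' c'
    by (auto simp: closed_segment_def)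
  consider (up) "(x, y, z) \<in> closed_segment (real i, 0, real m) (real i, 0, real m + h)"
    | (over) "(x, y, z) \<in> closed_segment (real i, 0, real m + h) (real n + h, 0, real m + h)"
    | (down) "(x, y, z) \<in> closed_segment (real n + h, 0, real m + h) (real n + h, 0, - h)"
    | (under) "(x, y, z) \<in> closed_segment (real n + h, 0, - h) (real i, 0, - h)"
    | (home) "(x, y, z) \<in> closed_segment (real i, 0, - h) (real i, 0, 0)"
    using assms(1) unfolding closing_arc_def Let_def h_def[symmetric] Un_iff by argo
  then show ?thesis
  proof cases
    case up
    from seg[OF this] h show ?thesis by (simp add: closed_segment_eq_real_ivl)
  next
    case over
    from seg[OF this] h show ?thesis by (simp add: closed_segment_eq_real_ivl)
  next
    case down
    from seg[OF this] h show ?thesis by (simp add: closed_segment_eq_real_ivl)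
  next
    case under
    from seg[OF this] h show ?thesis by (simp add: closed_segment_eq_real_ivl split: if_splits)
  next
    case home
    from seg[OF this] h show ?thesis by (simp add: closed_segment_eq_real_ivl)
  qed
qed

text \<open>
  The arcs are nested: each of the five sides lies on a line whose position determines \<open>i\<close>, and
  sides in different directions do not meet, since a smaller \<open>i\<close> means a wider and taller arc.
\<close>

lemma closing_arc_disjoint:
  assumes "p \<in> closing_arc n m i" "p \<in> closing_arc n m i'" "i \<in> {1..n}" "i' \<in> {1..n}"
  shows "i = i'"
proof -
  obtain x y z where p: "p = (x, y, z)" by (cases p)
  have "real i \<ge> 1" "real i' \<ge> 1" "real i \<le> real n" "real i' \<le> real n" "0 \<le> real m"
    using assms(3,4) by auto
  then have "real i = real i'"
    using closing_arc_coordinates[OF assms(1)[unfolded p] assms(3)]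
      closing_arc_coordinates[OF assms(2)[unfolded p] assms(4)]
    by (elim disjE; linarith)
  then show ?thesis by simp
qed

lemma closing_arc_ends:
  "(real i, 0, 0) \<in> closing_arc n m i" "(real i, 0, real m) \<in> closing_arc n m i"
  by (auto simp: closing_arc_def Let_def)

lemma closed_closing_arc: "closed (closing_arc n m i)"
  by (auto simp: closing_arc_def Let_def intro!: closed_Un)

lemma connected_closing_arc: "connected (closing_arc n m i)"
  unfolding closing_arc_def Let_def
  by (intro connected_Un) (auto simp: disjoint_iff intro: ends_in_segment)

text \<open>
  If \<open>C\<close> is a union of cycles of \<open>braid_perm u\<close>, this is the sublink of the closed braid that is formed
  by the strands starting in \<open>C\<close>. For a single cycle it turns out to be a component.
\<close>

definition link_part :: "nat \<Rightarrow> braid_word \<Rightarrow> nat set \<Rightarrow> point3 set" where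
  "link_part n u C =
     (\<Union>k\<in>{..<length u}. \<Union>j\<in>{j \<in> {1..n}. braid_perm (take k u) j \<in> C}. strand k (u ! k) j) \<union>
     (\<Union>i\<in>{1..n} \<inter> C. closing_arc n (length u) i)"

lemma link_part_cases:
  assumes "p \<in> link_part n u C"
  obtains (strand) k j where "k < length u" "j \<in> {1..n}" "braid_perm (take k u) j \<in> C"
      "p \<in> strand k (u ! k) j"
    | (arc) i where "i \<in> {1..n}" "i \<in> C" "p \<in> closing_arc n (length u) i"
  using assms unfolding link_part_def by blast

lemma closed_link_part: "closed (link_part n u C)"
  unfolding link_part_def
  by (intro closed_Un closed_UN ballI closed_strand closed_closing_arc finite_Int) auto

lemma braid_perm_take_Suc:
  assumes "k < length u"
  shows "braid_perm (take (Suc k) u) (adj_transp (fst (u ! k)) j) = braid_perm (take k u) j"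
  using assms by (simp add: take_Suc_conv_app_nth)

text \<open>
  Strands of different letters meet only end to end, and there the letter between the two heights moves the position
  in the same way as it moves the strand.
\<close>

lemma strands_meet_same_label:
  assumes "p \<in> strand k (u ! k) j" "p \<in> strand k' (u ! k') j'" "k \<le> k'" "k' < length u"
  shows "braid_perm (take k u) j = braid_perm (take k' u) j'"
proof -
  obtain x y z where p: "p = (x, y, z)" by (cases p)
  note r = strand_range[OF assms(1)[unfolded p]] and r' = strand_range[OF assms(2)[unfolded p]]
  have "real k' \<le> real k + 1" using r(2) r'(1) by linarith
  then consider "k' = k" | "k' = Suc k" using assms(3) by linarith
  then show ?thesis
  proof cases
    case 1
    then show ?thesis using strand_disjoint assms(1,2) by blast
  next
    case 2
    then have "z = real k + 1" using r(2) r'(1) by simp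
    then have "j' = adj_transp (fst (u ! k)) j" using 2 r(4) r'(3) by simp
    then show ?thesis using 2 assms(4) braid_perm_take_Suc[of k u j] by simp
  qed
qed

text \<open>
  The strand touches the arc at its bottom end in the first case and at its top end in the second.
\<close>

lemma strand_meets_arc_label:
  assumes "u \<in> braid_words n" "p \<in> strand k (u ! k) j" "p \<in> closing_arc n (length u) i"
    and "k < length u" "i \<in> {1..n}" "j \<in> {1..n}"
  shows "braid_perm (take k u) j = i \<or> braid_perm (take k u) j = braid_perm u i"
proof -
  obtain x y z where p: "p = (x, y, z)" by (cases p)
  have "u ! k \<in> set u" using assms(4) by simp
  then have gen: "fst (u ! k) \<in> {1..<n}" using assms(1) by (auto simp: braid_words_def)
  note r = strand_range[OF assms(2)[unfolded p]]
  have x: "x \<le> real n" using r(5)[OF gen assms(6)] .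
  have k: "real k + 1 \<le> real (length u)" using assms(4) by linarith
  have "real i \<le> real n" using assms(5) by simp
  then have "x = real i \<and> (z = real (length u) \<or> z = 0)"
    using closing_arc_coordinates[OF assms(3)[unfolded p] assms(5)] x r(1,2) k
    by (elim disjE) auto
  then consider "x = real i" "z = real (length u)" | "x = real i" "z = 0" by blast
  then show ?thesis
  proof cases
    case 1
    then have "real (length u) = real k + 1" using r(2) k by linarith
    then have len: "length u = Suc k" by linarith
    then have "i = adj_transp (fst (u ! k)) j" using 1 r(4) by simp
    then show ?thesis using braid_perm_take_Suc[OF assms(4), of j] len by simp
  next
    case 2
    then have "k = 0" using r(1) by simp
    then show ?thesis using 2 r(3) by simp
  qed
qed

text \<open>
  Pieces that touch come from starting positions that are equal or differ by one application of
  the permutation, so their cycles coincide.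
\<close>

lemma link_parts_meet_imp_eq:
  assumes u: "u \<in> braid_words n" and a: "a \<in> {1..n}" "b \<in> {1..n}"
    and p: "p \<in> link_part n u (orbit (braid_perm u) a)" "p \<in> link_part n u (orbit (braid_perm u) b)"
  shows "orbit (braid_perm u) a = orbit (braid_perm u) b"
proof -
  note perm = braid_perm_permutes[OF u]
  have "\<exists>c. c \<in> orbit (braid_perm u) a \<and> c \<in> orbit (braid_perm u) b"
    using p(1)
  proof (cases rule: link_part_cases)
    case s: (strand k j)
    show ?thesis using p(2)
    proof (cases rule: link_part_cases)
      case s': (strand k' j')
      then have "braid_perm (take k u) j = braid_perm (take k' u) j'"
        using s strands_meet_same_label[of p k u j k' j'] strands_meet_same_label[of p k' u j' k j]
        by (cases "k \<le> k'") auto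
      then show ?thesis using s s' by auto
    next
      case (arc i)
      then show ?thesis
        using s strand_meets_arc_label[OF u s(4) arc(3) s(1) arc(1) s(2)] orbit.step[OF arc(2)]
        by auto
    qed
  next
    case r: (arc i)
    show ?thesis using p(2)
    proof (cases rule: link_part_cases)
      case (strand k j)
      then show ?thesis
        using r strand_meets_arc_label[OF u strand(4) r(3) strand(1) r(1) strand(2)]
          orbit.step[OF r(2)] strand(3) by auto
    next
      case (arc i')
      then show ?thesis using r closing_arc_disjoint by blast
    qed
  qed
  then show ?thesis using permutes_orbit_eq[OF finite_atLeastAtMost perm] by blast
qed

text \<open>
  From any point one can descend along the strands to the starting position. Conversely, from
  the starting position \<open>c\<close> the closing arc leads to the top, and the descent from there ends in the
  position \<open>braid_perm u c\<close>; repeating this visits the whole cycle.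
\<close>

lemma connected_link_part:
  assumes u: "u \<in> braid_words n" and a: "a \<in> {1..n}"
  shows "connected (link_part n u (orbit (braid_perm u) a))"
proof -
  define C where "C = orbit (braid_perm u) a"
  define S where "S = link_part n u C"
  let ?pt = "\<lambda>j k. (real j, 0 :: real, real (k :: nat))"
  note perm = braid_perm_permutes[OF u]
  have C_sub: "C \<subseteq> {1..n}" unfolding C_def by (rule permutes_orbit_subset[OF perm a])
  have joined: "connected_component S p q"
    if "p \<in> T" "q \<in> T" "connected T" "T \<subseteq> S" for p q T
    using that unfolding connected_component_def by blast
  have via_strand: "connected_component S p q"
    if "k < length u" "j \<in> {1..n}" "braid_perm (take k u) j \<in> C"
      "p \<in> strand k (u ! k) j" "q \<in> strand k (u ! k) j" for k j p q
    by (rule joined[OF that(4,5) connected_strand]) (use that in \<open>auto simp: S_def link_part_def\<close>)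
  have via_arc: "connected_component S p q"
    if "i \<in> C" "p \<in> closing_arc n (length u) i" "q \<in> closing_arc n (length u) i" for i p q
    by (rule joined[OF that(2,3) connected_closing_arc])
      (use that C_sub in \<open>auto simp: S_def link_part_def\<close>)
  have down: "connected_component S (?pt j k) (?pt (braid_perm (take k u) j) 0)"
    if "k \<le> length u" "j \<in> {1..n}" "braid_perm (take k u) j \<in> C" for j k
    using that
  proof (induction k arbitrary: j)
    case 0
    then show ?case using via_arc[OF _ closing_arc_ends(1) closing_arc_ends(1), of j] by simp
  next
    case (Suc k)
    define j' where "j' = adj_transp (fst (u ! k)) j"
    have k: "k < length u" using Suc.prems(1) by simp
    have label: "braid_perm (take (Suc k) u) j = braid_perm (take k u) j'"
      using braid_perm_take_Suc[OF k, of j'] by (simp add: j'_def)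
    have "u ! k \<in> set u" using k by simp
    then have "fst (u ! k) \<in> {1..<n}" using u by (auto simp: braid_words_def)
    then have j': "j' \<in> {1..n}"
      unfolding j'_def using permutes_in_image[OF adj_transp_permutes] Suc.prems(2) by blast
    have "connected_component S (?pt j (Suc k)) (?pt j' k)"
      by (rule via_strand[OF k j'])
        (use Suc.prems(3) label strand_ends[where j = j' and k = k and l = "u ! k"] in \<open>simp_all add: j'_def\<close>)
    moreover have "connected_component S (?pt j' k) (?pt (braid_perm (take k u) j') 0)"
      using Suc.IH[of j'] k j' label Suc.prems(3) by simp
    ultimately show ?case unfolding label by (rule connected_component_trans)
  qed
  have next_strand: "connected_component S (?pt c 0) (?pt (braid_perm u c) 0)" if "c \<in> C" for c
  proof -
    have "connected_component S (?pt c 0) (?pt c (length u))"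
      by (rule via_arc[OF that]) (simp_all add: closing_arc_ends)
    moreover have "connected_component S (?pt c (length u)) (?pt (braid_perm u c) 0)"
      using down[of "length u" c] that C_sub orbit.step[of c "braid_perm u" a]
      by (auto simp: C_def)
    ultimately show ?thesis by (rule connected_component_trans)
  qed
  have aC: "a \<in> C" unfolding C_def using permutes_in_orbit_self[OF _ perm] by simp
  have along: "connected_component S (?pt a 0) (?pt c 0)" if "c \<in> C" for c
  proof (rule orbit.induct[of c "braid_perm u" a "\<lambda>c. connected_component S (?pt a 0) (?pt c 0)"])
    show "c \<in> orbit (braid_perm u) a" using that by (simp only: C_def)
    show "connected_component S (?pt a 0) (?pt (braid_perm u a) 0)" by (rule next_strand[OF aC])
    fix y assume "y \<in> orbit (braid_perm u) a"
      and IH: "connected_component S (?pt a 0) (?pt y 0)"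
    then have "y \<in> C" by (simp only: C_def)
    from next_strand[OF this] show "connected_component S (?pt a 0) (?pt (braid_perm u y) 0)"
      by (rule connected_component_trans[OF IH])
  qed
  have to_base: "connected_component S (?pt a 0) p" if "p \<in> S" for p
    using that[unfolded S_def]
  proof (cases rule: link_part_cases)
    case (strand k j)
    have "connected_component S (?pt (braid_perm (take k u) j) 0) (?pt j k)"
      by (rule connected_component_sym, rule down) (use strand(1-3) in simp_all)
    moreover have "connected_component S (?pt j k) p"
      by (rule via_strand[OF strand(1-3) strand_ends(1) strand(4)])
    ultimately have "connected_component S (?pt (braid_perm (take k u) j) 0) p"
      by (rule connected_component_trans)
    then show ?thesis by (rule connected_component_trans[OF along[OF strand(3)]])
  next
    case (arc i)
    have "connected_component S (?pt i 0) p"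
      by (rule via_arc[OF arc(2) _ arc(3)]) (simp add: closing_arc_ends)
    then show ?thesis by (rule connected_component_trans[OF along[OF arc(2)]])
  qed
  have "connected_component S p q" if "p \<in> S" "q \<in> S" for p q
    by (rule connected_component_trans[OF connected_component_sym[OF to_base[OF that(1)]]
      to_base[OF that(2)]])
  then have "connected S" unfolding connected_iff_connected_component by blast
  then show ?thesis by (simp add: S_def C_def)
qed

lemma num_components_word_closure:
  assumes u: "u \<in> braid_words n"
  shows "num_components (word_closure n u) = num_cycles {1..n} (braid_perm u)"
proof -
  define w where "w = braid_perm u"
  have perm: "w permutes {1..n}" unfolding w_def by (rule braid_perm_permutes[OF u])
  let ?part = "link_part n u"
  let ?O = "orbit w ` {1..n}"
  have nonempty: "?part (orbit w a) \<noteq> {}" if "a \<in> {1..n}" for a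
  proof -
    have "a \<in> {1..n} \<inter> orbit w a" using permutes_in_orbit_self[OF _ perm] that by simp
    then show ?thesis
      using closing_arc_ends(1)[of a n "length u"] unfolding link_part_def by blast
  qed
  have take_perm: "braid_perm (take k u) j \<in> {1..n}" if "j \<in> {1..n}" for k j
  proof -
    have "take k u \<in> braid_words n" using u set_take_subset[of k u] by (auto simp: braid_words_def)
    then show ?thesis using permutes_in_image[OF braid_perm_permutes] that by blast
  qed
  have "p \<in> \<Union>(?part ` ?O)" if "p \<in> word_closure n u" for p
  proof -
    have "\<exists>c\<in>{1..n}. p \<in> ?part (orbit w c)"
      using that unfolding word_closure_def geometric_braid_def
    proof (elim UnE UN_E)
      fix k j assume "k \<in> {..<length u}" "j \<in> {1..n}" "p \<in> strand k (u ! k) j"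
      then show ?thesis
        using take_perm[of j k] permutes_in_orbit_self[OF _ perm, of "braid_perm (take k u) j"]
        by (intro bexI[of _ "braid_perm (take k u) j"]) (auto simp: link_part_def)
    next
      fix i assume "i \<in> {1..n}" "p \<in> closing_arc n (length u) i"
      then show ?thesis
        using permutes_in_orbit_self[OF _ perm, of i]
        by (intro bexI[of _ i]) (auto simp: link_part_def)
    qed
    then show ?thesis by blast
  qed
  moreover have "?part C \<subseteq> word_closure n u" for C
    unfolding link_part_def word_closure_def geometric_braid_def by blast
  ultimately have closure: "word_closure n u = \<Union>(?part ` ?O)" by blast
  have "components (word_closure n u) = ?part ` ?O"
    unfolding closure
  proof (rule components_disjoint_closed_family)
    show "closed C \<and> connected C \<and> C \<noteq> {}" if "C \<in> ?part ` ?O" for C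
    proof -
      from that obtain a where a: "a \<in> {1..n}" "C = ?part (orbit w a)" by blast
      show ?thesis
        unfolding a(2) using nonempty[OF a(1)] closed_link_part connected_link_part[OF u a(1)]
        by (simp add: w_def)
    qed
    show "C \<inter> D = {}" if "C \<in> ?part ` ?O" "D \<in> ?part ` ?O" "C \<noteq> D" for C D
    proof -
      from that obtain a b where ab: "a \<in> {1..n}" "b \<in> {1..n}"
        "C = ?part (orbit w a)" "D = ?part (orbit w b)" by blast
      have False if "p \<in> C" "p \<in> D" for p
        using link_parts_meet_imp_eq[OF u ab(1,2), of p] that \<open>C \<noteq> D\<close> ab(3,4) by (simp add: w_def)
      then show ?thesis by blast
    qed
  qed simp
  moreover have "inj_on ?part ?O"
  proof (rule inj_onI, elim imageE)
    fix C D a b assume *: "?part C = ?part D" "C = orbit w a" "D = orbit w b"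
      and ab: "a \<in> {1..n}" "b \<in> {1..n}"
    obtain p where "p \<in> ?part (orbit w a)" using nonempty[OF ab(1)] by blast
    then show "C = D"
      using link_parts_meet_imp_eq[OF u ab, of p] * by (simp add: w_def)
  qed
  ultimately show ?thesis
    by (simp add: num_components_def num_cycles_def card_image w_def)
qed

section \<open>Closures of braid lifts\<close>

lemma perm_of_word_eq_braid_perm: "perm_of_word n is = braid_perm (map (\<lambda>i. (i, True)) is)"
  by (induction "is") (simp_all add: perm_of_word_def sym_group_mult sym_group_one)

text \<open>
  Induction on the distance: conjugating \<open>(a b)\<close> by \<open>(b b+1)\<close> gives \<open>(a b+1)\<close>.
\<close>

lemma transpose_eq_perm_of_word:
  assumes "1 \<le> a" "a < b" "b \<le> n"
  shows "\<exists>js\<in>lists {1..<n}. perm_of_word n js = Transposition.transpose a b"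
proof -
  from assms(2) have "Suc a \<le> b" by simp
  then show ?thesis using assms(3)
  proof (induction b rule: dec_induct)
    case base
    then show ?case using assms(1)
      by (intro bexI[of _ "[a]"]) (auto simp: perm_of_word_eq_braid_perm adj_transp_def)
  next
    case (step b)
    then obtain js where js: "js \<in> lists {1..<n}" "perm_of_word n js = Transposition.transpose a b"
      by auto
    have "Transposition.transpose a (Suc b) = adj_transp b \<circ> Transposition.transpose a b \<circ> adj_transp b"
      using step.hyps by (auto simp: adj_transp_def fun_eq_iff Transposition.transpose_def)
    then have "perm_of_word n ([b] @ js @ [b]) = Transposition.transpose a (Suc b)"
      using js(2) by (simp add: perm_of_word_eq_braid_perm comp_assoc)
    moreover have "[b] @ js @ [b] \<in> lists {1..<n}" using js(1) step.hyps step.prems assms(1) by auto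
    ultimately show ?case by blast
  qed
qed

lemma perm_of_word_surj:
  assumes "w permutes {1..n}"
  obtains js where "js \<in> lists {1..<n}" "perm_of_word n js = w"
proof -
  have "\<exists>js\<in>lists {1..<n}. perm_of_word n js = w"
    using assms finite_atLeastAtMost
  proof (induction rule: permutes_induct)
    case id
    show ?case by (intro bexI[of _ "[]"]) (auto simp: perm_of_word_eq_braid_perm)
  next
    case (swap a b p)
    then obtain js where js: "js \<in> lists {1..<n}" "perm_of_word n js = p" by blast
    obtain ts where ts: "ts \<in> lists {1..<n}" "perm_of_word n ts = Transposition.transpose a b"
      using transpose_eq_perm_of_word[of a b n] transpose_eq_perm_of_word[of b a n] swap.hyps
      by (auto simp: transpose_commute elim: linorder_neqE_nat)
    have "perm_of_word n (ts @ js) = Transposition.transpose a b \<circ> p"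
      using js(2) ts(2) by (simp add: perm_of_word_eq_braid_perm)
    moreover have "ts @ js \<in> lists {1..<n}" using js(1) ts(1) by simp
    ultimately show ?case by blast
  qed
  then show ?thesis using that by blast
qed

lemma braid_rel_imp_braid_perm_eq:
  assumes "(u, v) \<in> braid_rel n"
  shows "braid_perm u = braid_perm v"
  using assms
proof (induction rule: braid_rel.induct)
  case (cancel i e)
  show ?case by (simp add: fun_eq_iff)
next
  case (commute i j)
  then show ?case by (auto simp: fun_eq_iff adj_transp_def Transposition.transpose_def)
next
  case (braid i)
  show ?case by (auto simp: fun_eq_iff adj_transp_def Transposition.transpose_def)
qed simp_all

lemma braid_group_foldr_gens:
  assumes "is \<in> lists {1..<n}"
  shows "map (\<lambda>i. (i, True)) is \<in> braid_words n"
    and "foldr (mult (braid_group n)) (map (braid_gen n) is) (one (braid_group n)) =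
      braid_rel n `` {map (\<lambda>i. (i, True)) is}"
proof -
  have words: "map (\<lambda>i. (i, True)) js \<in> braid_words n" if "js \<in> lists {1..<n}" for js
    using that by (auto simp: braid_words_def)
  show "map (\<lambda>i. (i, True)) is \<in> braid_words n" using words[OF assms] .
  show "foldr (mult (braid_group n)) (map (braid_gen n) is) (one (braid_group n)) =
      braid_rel n `` {map (\<lambda>i. (i, True)) is}"
    using assms
  proof (induction "is")
    case Nil
    show ?case by (simp add: braid_group_def)
  next
    case (Cons i "is")
    then have "[(i, True)] \<in> braid_words n" "map (\<lambda>i. (i, True)) is \<in> braid_words n"
      using words[of "[i]"] words[of "is"] by auto
    then show ?case
      using Cons by (simp add: braid_gen_def braid_group_mult_class)
  qed
qed

text \<open>
  Whichever reduced expression of \<open>w\<close> the lift is built from, and whichever word represents it, the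
  underlying permutation of the word is \<open>w\<close>.
\<close>

lemma num_components_closure_lift:
  assumes "w permutes {1..n}"
  shows "num_components (braid_closure n (braid_lift n w)) = num_cycles {1..n} w"
proof -
  let ?P = "\<lambda>js. js \<in> lists {1..<n} \<and> perm_of_word n js = w"
  obtain js where "?P js" using perm_of_word_surj[OF assms] by blast
  then have "\<exists>is. reduced_expression n w is"
    unfolding reduced_expression_def using ex_has_least_nat[of ?P js length]
    by (auto simp: is_arg_min_linorder)
  then obtain ks where lift: "braid_lift n w =
      foldr (mult (braid_group n)) (map (braid_gen n) ks) (one (braid_group n))"
    and "reduced_expression n w ks"
    unfolding braid_lift_def using someI_ex by metis
  then have ks: "ks \<in> lists {1..<n}" "perm_of_word n ks = w"
    by (auto simp: reduced_expression_def is_arg_min_def)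
  have lift: "braid_lift n w = braid_rel n `` {map (\<lambda>i. (i, True)) ks}"
    unfolding lift by (rule braid_group_foldr_gens(2)[OF ks(1)])
  define u where "u = (SOME u. u \<in> braid_lift n w)"
  have "map (\<lambda>i. (i, True)) ks \<in> braid_lift n w"
    unfolding lift using braid_rel.refl[OF braid_group_foldr_gens(1)[OF ks(1)]] by simp
  then have "u \<in> braid_lift n w" unfolding u_def by (rule someI)
  then have rel: "(map (\<lambda>i. (i, True)) ks, u) \<in> braid_rel n" unfolding lift by simp
  then have "braid_perm u = w"
    using braid_rel_imp_braid_perm_eq ks(2) perm_of_word_eq_braid_perm by metis
  then show ?thesis
    using num_components_word_closure[of u n] braid_rel_words[OF rel]
    by (simp add: braid_closure_def u_def)
qed

section \<open>Repeated averaging over a finite set\<close>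

text \<open>
  The shortfall of the average below \<open>M\<close> is the average of the shortfalls; all of these are
  nonnegative, so a single one bounds it from below.
\<close>

lemma average_le_upper_bound_minus_gap:
  fixes K :: "'s \<Rightarrow> 's \<Rightarrow> real"
  assumes "finite A" "\<And>a b. a \<in> A \<Longrightarrow> b \<in> A \<Longrightarrow> 0 \<le> K b a" "\<And>b. b \<in> A \<Longrightarrow> (\<Sum>a\<in>A. K b a) = 1"
    and "\<And>a. a \<in> A \<Longrightarrow> v a \<le> M" "b \<in> A" "c \<in> A"
  shows "(\<Sum>a\<in>A. K b a * v a) \<le> M - K b c * (M - v c)"
proof -
  have "K b c * (M - v c) \<le> (\<Sum>a\<in>A. K b a * (M - v a))"
    using assms by (intro member_le_sum) auto
  also have "\<dots> = M * (\<Sum>a\<in>A. K b a) - (\<Sum>a\<in>A. K b a * v a)"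
    by (simp add: sum_subtractf sum_distrib_left algebra_simps)
  finally show ?thesis using assms(3,5) by simp
qed

text \<open>
  The maximum of \<open>v k\<close> decreases and the minimum increases in \<open>k\<close>. By irreducibility and the positive
  diagonal there is one length \<open>L\<close> such that any two points are joined by a path of exactly this
  length. Along the path the gap between the old maximum and a minimal value is multiplied in each
  step at least by \<open>\<delta>\<close>, a lower bound for the positive weights. So after \<open>L\<close> steps all values are below the
  old maximum by at least \<open>\<delta> ^ L\<close> times the oscillation, which therefore decays geometrically.
\<close>

lemma irreducible_averaging_converges:
  fixes K :: "'s \<Rightarrow> 's \<Rightarrow> real" and v :: "nat \<Rightarrow> 's \<Rightarrow> real"
  assumes "finite A" "A \<noteq> {}"
    and nonneg: "\<And>a b. a \<in> A \<Longrightarrow> b \<in> A \<Longrightarrow> 0 \<le> K b a"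
    and rows: "\<And>b. b \<in> A \<Longrightarrow> (\<Sum>a\<in>A. K b a) = 1"
    and diag: "\<And>a. a \<in> A \<Longrightarrow> K a a > 0"
    and irred: "\<And>a b. a \<in> A \<Longrightarrow> b \<in> A \<Longrightarrow> (a, b) \<in> {(x, y). x \<in> A \<and> y \<in> A \<and> K y x > 0}\<^sup>*"
    and step: "\<And>k b. b \<in> A \<Longrightarrow> v (Suc k) b = (\<Sum>a\<in>A. K b a * v k a)"
  obtains l where "\<And>a. a \<in> A \<Longrightarrow> (\<lambda>k. v k a) \<longlonglongrightarrow> l"
proof -
  let ?R = "{(x, y). x \<in> A \<and> y \<in> A \<and> K y x > 0}"
  define hi where "hi k = Max (v k ` A)" for k
  define lo where "lo k = Min (v k ` A)" for k
  have le_hi: "v k a \<le> hi k" and ge_lo: "lo k \<le> v k a" if "a \<in> A" for k a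
    using that assms(1) by (auto simp: hi_def lo_def)
  \<comment> \<open>The positive diagonal lets paths wait, so the sum of all path lengths serves every pair.\<close>
  obtain L where L: "\<And>a b. a \<in> A \<Longrightarrow> b \<in> A \<Longrightarrow> (a, b) \<in> ?R ^^ L"
  proof -
    have "\<forall>p\<in>A \<times> A. \<exists>k. p \<in> ?R ^^ k" using irred by (auto simp: rtrancl_power)
    then obtain d where d: "\<And>p. p \<in> A \<times> A \<Longrightarrow> p \<in> ?R ^^ d p"
      using bchoice[of "A \<times> A" "\<lambda>p k. p \<in> ?R ^^ k"] by blast
    have longer: "(a, b) \<in> ?R ^^ (k + j)" if "(a, b) \<in> ?R ^^ k" "b \<in> A" for a b k j
      using that diag by (induction j) auto
    have "(a, b) \<in> ?R ^^ sum d (A \<times> A)" if ab: "a \<in> A" "b \<in> A" for a b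
    proof -
      have "d (a, b) \<le> sum d (A \<times> A)" using ab assms(1) by (intro member_le_sum) auto
      then show ?thesis using longer[OF d, of a b "sum d (A \<times> A) - d (a, b)"] ab by simp
    qed
    then show ?thesis using that by blast
  qed
  \<comment> \<open>The element \<open>1\<close> makes the set nonempty and ensures \<open>\<delta> \<le> 1\<close>.\<close>
  define \<delta> where "\<delta> = Min (insert 1 {K y x | x y. (x, y) \<in> ?R})"
  have fin: "finite {K y x | x y. (x, y) \<in> ?R}"
    using finite_imageI[of "A \<times> A" "\<lambda>(x, y). K y x"] assms(1)
    by (rule_tac finite_subset[of _ "(\<lambda>(x, y). K y x) ` (A \<times> A)"]) auto
  have \<delta>: "0 < \<delta>" "\<delta> \<le> 1" using fin by (auto simp: \<delta>_def)
  have \<delta>_le: "\<delta> \<le> K y x" if "(x, y) \<in> ?R" for x y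
    unfolding \<delta>_def using fin that by (intro Min_le) auto
  have hi_Suc: "hi (Suc k) \<le> hi k" and lo_Suc: "lo k \<le> lo (Suc k)" for k
  proof -
    have "v (Suc k) b \<le> hi k" if "b \<in> A" for b
    proof -
      have "0 \<le> K b b * (hi k - v k b)" using nonneg le_hi that by simp
      moreover have "v (Suc k) b \<le> hi k - K b b * (hi k - v k b)"
        unfolding step[OF that]
        by (rule average_le_upper_bound_minus_gap[OF assms(1) nonneg rows _ that that]) (use le_hi in auto)
      ultimately show ?thesis by linarith
    qed
    then show "hi (Suc k) \<le> hi k" using assms(1,2) by (auto simp: hi_def[of "Suc k"])
    have "lo k \<le> v (Suc k) b" if "b \<in> A" for b
    proof -
      have "0 \<le> K b b * (v k b - lo k)" using nonneg ge_lo that by simp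
      moreover have "(\<Sum>a\<in>A. K b a * (- v k a)) \<le> - lo k - K b b * (- lo k - (- v k b))"
        by (rule average_le_upper_bound_minus_gap[OF assms(1) nonneg rows _ that that]) (use ge_lo in auto)
      ultimately show ?thesis using step[OF that] by (simp add: sum_negf)
    qed
    then show "lo k \<le> lo (Suc k)" using assms(1,2) by (auto simp: lo_def[of "Suc k"])
  qed
  have dec: "decseq hi" and inc: "incseq lo"
    using hi_Suc lo_Suc by (blast intro: decseq_SucI incseq_SucI)+
  have contract: "hi (k + L) - lo (k + L) \<le> (1 - \<delta> ^ L) * (hi k - lo k)" for k
  proof -
    obtain a where a: "a \<in> A" "v k a = lo k"
      using Min_in[of "v k ` A"] assms(1,2) by (fastforce simp: lo_def)
    have hi_add: "hi (k + j) \<le> hi k" for j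
      using decseqD[OF dec] by simp
    have lo_add: "lo k \<le> lo (k + j)" for j
      using incseqD[OF inc] by simp
    have "v (k + j) b \<le> hi k - \<delta> ^ j * (hi k - lo k)" if "(a, b) \<in> ?R ^^ j" for j b
      using that
    proof (induction j arbitrary: b)
      case 0
      then show ?case using a by simp
    next
      case (Suc j)
      then obtain c where c: "(a, c) \<in> ?R ^^ j" "(c, b) \<in> ?R" by auto
      have "v (k + Suc j) b \<le> hi k - K b c * (hi k - v (k + j) c)"
      proof -
        have "v (k + j) x \<le> hi k" if "x \<in> A" for x
          using le_hi[OF that, of "k + j"] hi_add[of j] by simp
        then have "(\<Sum>x\<in>A. K b x * v (k + j) x) \<le> hi k - K b c * (hi k - v (k + j) c)"
          by (intro average_le_upper_bound_minus_gap[OF assms(1) nonneg rows]) (use c(2) in auto)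
        then show ?thesis using step[of b "k + j"] c(2) by simp
      qed
      moreover have "\<delta> * (\<delta> ^ j * (hi k - lo k)) \<le> K b c * (hi k - v (k + j) c)"
        using Suc.IH[OF c(1)] \<delta> \<delta>_le[OF c(2)] le_hi[OF a(1), of k] a(2)
        by (intro mult_mono) auto
      ultimately show ?case by simp
    qed
    then have "hi (k + L) \<le> hi k - \<delta> ^ L * (hi k - lo k)"
      using L[OF a(1)] assms(1,2) by (auto simp: hi_def[of "k + L"])
    then show ?thesis using lo_add[of L] by (simp add: algebra_simps)
  qed
  define \<rho> where "\<rho> = 1 - \<delta> ^ L"
  have \<rho>: "0 \<le> \<rho>" "\<rho> < 1" using \<delta> by (auto simp: \<rho>_def power_le_one)
  have osc: "hi (j * L) - lo (j * L) \<le> \<rho> ^ j * (hi 0 - lo 0)" for j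
  proof (induction j)
    case (Suc j)
    have "hi (Suc j * L) - lo (Suc j * L) \<le> \<rho> * (hi (j * L) - lo (j * L))"
      using contract[of "j * L"] by (simp add: \<rho>_def add.commute)
    also have "\<dots> \<le> \<rho> * (\<rho> ^ j * (hi 0 - lo 0))" using Suc \<rho> by (intro mult_left_mono)
    finally show ?case by simp
  qed simp
  obtain a0 where a0: "a0 \<in> A" using assms(2) by blast
  have lo_hi: "lo k \<le> hi k" for k using ge_lo[OF a0] le_hi[OF a0] order_trans by blast
  have bd: "\<forall>k. lo 0 \<le> hi k"
    using incseqD[OF inc, of 0] lo_hi order_trans by blast
  obtain l where l: "hi \<longlonglongrightarrow> l" using decseq_convergent[OF dec bd] by blast
  have "(\<lambda>k. hi k - lo k) \<longlonglongrightarrow> 0"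
  proof (rule LIMSEQ_I)
    fix e :: real assume "e > 0"
    have "(\<lambda>j. \<rho> ^ j * (hi 0 - lo 0)) \<longlonglongrightarrow> 0 * (hi 0 - lo 0)"
      using \<rho> by (intro tendsto_intros LIMSEQ_realpow_zero)
    then obtain j where j: "\<rho> ^ j * (hi 0 - lo 0) < e"
      using \<open>e > 0\<close> by (force dest!: order_tendstoD(2)[of _ _ _ e] simp: eventually_sequentially)
    have "norm (hi k - lo k - 0) < e" if "k \<ge> j * L" for k
      using decseqD[OF dec that] incseqD[OF inc that] osc[of j] j lo_hi[of k] by simp
    then show "\<exists>k0. \<forall>k\<ge>k0. norm (hi k - lo k - 0) < e" by blast
  qed
  from tendsto_diff[OF l this] have lo: "lo \<longlonglongrightarrow> l" by simp
  have "(\<lambda>k. v k a) \<longlonglongrightarrow> l" if "a \<in> A" for a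
    by (rule tendsto_sandwich[OF _ _ lo l]) (use ge_lo le_hi that in auto)
  then show ?thesis using that by blast
qed

section \<open>One-step distributions of finite Markov chains\<close>

lemma sets_value_eq:
  assumes "Y \<in> measurable M (count_space S)" "b \<in> S"
  shows "{\<omega> \<in> space M. Y \<omega> = b} \<in> sets M"
proof -
  have "Y -` {b} \<inter> space M \<in> sets M" using measurable_sets[OF assms(1)] assms(2) by simp
  then show ?thesis by (simp add: vimage_def Int_def conj_commute)
qed

text \<open>
  The transition probabilities are given for complete histories, so the event is split into the
  finitely many histories, and the histories are then grouped by their last state.
\<close>

lemma markov_chain_step:
  assumes "markov_chain M S P X" "finite S" "b \<in> S"
  shows "\<P>(\<omega> in M. X (Suc k) \<omega> = b) = (\<Sum>a\<in>S. \<P>(\<omega> in M. X k \<omega> = a) * P a b)"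
proof -
  interpret prob_space M using assms(1) by (simp add: markov_chain_def)
  have meas: "X j \<in> measurable M (count_space S)" for j
    using assms(1) by (simp add: markov_chain_def)
  have markov: "\<P>(\<omega> in M. X (Suc k) \<omega> = b \<bar> \<forall>j\<le>k. X j \<omega> = x j) = P (x k) b"
    if "\<P>(\<omega> in M. \<forall>j\<le>k. X j \<omega> = x j) > 0" for x
    using assms(1,3) that by (simp add: markov_chain_def)
  have in_S: "X j \<omega> \<in> S" if "\<omega> \<in> space M" for j \<omega>
    using measurable_space[OF meas that] by simp
  have at: "{\<omega> \<in> space M. X j \<omega> = a} \<in> events" if "a \<in> S" for j a
    by (rule sets_value_eq[OF meas that])
  define I where "I = {..k} \<rightarrow>\<^sub>E S"
  have finI: "finite I" unfolding I_def using assms(2) by (intro finite_PiE) auto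
  let ?H = "\<lambda>x \<omega>. \<forall>j\<le>k. X j \<omega> = x j"
  have hist: "{\<omega> \<in> space M. ?H x \<omega>} \<in> events" if "x \<in> I" for x
  proof -
    have "{\<omega> \<in> space M. \<forall>j\<in>{..k}. X j \<omega> = x j} \<in> events"
      using at that by (intro sets.sets_Collect_finite_All) (auto simp: I_def PiE_iff)
    then show ?thesis by (simp only: Ball_def atMost_iff)
  qed
  have joint_ev: "{\<omega> \<in> space M. X (Suc k) \<omega> = b \<and> ?H x \<omega>} \<in> events" if "x \<in> I" for x
  proof -
    have "{\<omega> \<in> space M. X (Suc k) \<omega> = b} \<inter> {\<omega> \<in> space M. ?H x \<omega>} \<in> events"
      using at[OF assms(3)] hist[OF that] by (rule sets.Int)
    moreover have "{\<omega> \<in> space M. X (Suc k) \<omega> = b} \<inter> {\<omega> \<in> space M. ?H x \<omega>} =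
        {\<omega> \<in> space M. X (Suc k) \<omega> = b \<and> ?H x \<omega>}" by blast
    ultimately show ?thesis by (simp only:)
  qed
  have unique: "\<exists>!x. x \<in> I \<and> ?H x \<omega>" if "\<omega> \<in> space M" for \<omega>
  proof (rule ex1I[of _ "restrict (\<lambda>j. X j \<omega>) {..k}"])
    fix x assume "x \<in> I \<and> ?H x \<omega>"
    then show "x = restrict (\<lambda>j. X j \<omega>) {..k}"
      by (intro PiE_ext[of x "{..k}" "\<lambda>_. S"]) (auto simp: I_def in_S that)
  qed (auto simp: I_def in_S that)
  have joint: "\<P>(\<omega> in M. X (Suc k) \<omega> = b \<and> ?H x \<omega>) = \<P>(\<omega> in M. ?H x \<omega>) * P (x k) b"
    if "x \<in> I" for x
  proof (cases "\<P>(\<omega> in M. ?H x \<omega>) > 0")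
    case True
    have mult: "u = v * r" if "u / v = r" "v > 0" for u v r :: real using that by auto
    show ?thesis by (rule mult[OF markov[OF True, unfolded cond_prob_def] True])
  next
    case False
    then have zero: "\<P>(\<omega> in M. ?H x \<omega>) = 0" by (simp only: zero_less_measure_iff not_not)
    have "\<P>(\<omega> in M. X (Suc k) \<omega> = b \<and> ?H x \<omega>) \<le> \<P>(\<omega> in M. ?H x \<omega>)"
      by (intro finite_measure_mono hist[OF that]) blast
    then show ?thesis by (simp only: zero measure_le_0_iff mult_zero_left)
  qed
  have now: "\<P>(\<omega> in M. X k \<omega> = a) = (\<Sum>x\<in>{x \<in> I. x k = a}. \<P>(\<omega> in M. ?H x \<omega>))"
    if "a \<in> S" for a
  proof (rule prob_sum[where I = "{x \<in> I. x k = a}" and P = ?H and Q = "\<lambda>\<omega>. X k \<omega> = a"])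
    show "AE \<omega> in M. (\<forall>x\<in>{x \<in> I. x k = a}. ?H x \<omega> \<longrightarrow> X k \<omega> = a) \<and>
      (X k \<omega> = a \<longrightarrow> (\<exists>!x\<in>{x \<in> I. x k = a}. ?H x \<omega>))"
    proof (intro AE_I2 conjI ballI impI)
      fix \<omega> x assume "x \<in> {x \<in> I. x k = a}" "?H x \<omega>"
      then show "X k \<omega> = a" by simp
    next
      fix \<omega> assume \<omega>: "\<omega> \<in> space M" "X k \<omega> = a"
      obtain x0 where x0: "x0 \<in> I \<and> ?H x0 \<omega>"
        and only: "\<forall>x. x \<in> I \<and> ?H x \<omega> \<longrightarrow> x = x0"
        by (rule ex1E[OF unique[OF \<omega>(1)]])
      show "\<exists>!x. x \<in> {x \<in> I. x k = a} \<and> ?H x \<omega>"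
      proof (rule ex1I[of _ x0])
        have "x0 k = X k \<omega>" using x0 by simp
        then show "x0 \<in> {x \<in> I. x k = a} \<and> ?H x0 \<omega>" using x0 \<omega>(2) by blast
        show "x = x0" if "x \<in> {x \<in> I. x k = a} \<and> ?H x \<omega>" for x
          using only that by blast
      qed
    qed
    show "finite {x \<in> I. x k = a}" using finI by simp
    show "{\<omega> \<in> space M. X k \<omega> = a} \<in> events" by (rule at[OF that])
    show "{\<omega> \<in> space M. ?H x \<omega>} \<in> events" if "x \<in> {x \<in> I. x k = a}" for x
      using that by (intro hist) simp
  qed
  have "\<P>(\<omega> in M. X (Suc k) \<omega> = b) = (\<Sum>x\<in>I. \<P>(\<omega> in M. X (Suc k) \<omega> = b \<and> ?H x \<omega>))"
  proof (rule prob_sum[where I = I and P = "\<lambda>x \<omega>. X (Suc k) \<omega> = b \<and> ?H x \<omega>"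
        and Q = "\<lambda>\<omega>. X (Suc k) \<omega> = b"])
    show "AE \<omega> in M. (\<forall>x\<in>I. X (Suc k) \<omega> = b \<and> ?H x \<omega> \<longrightarrow> X (Suc k) \<omega> = b) \<and>
      (X (Suc k) \<omega> = b \<longrightarrow> (\<exists>!x\<in>I. X (Suc k) \<omega> = b \<and> ?H x \<omega>))"
    proof (intro AE_I2 conjI ballI impI)
      fix \<omega> assume \<omega>: "\<omega> \<in> space M" "X (Suc k) \<omega> = b"
      show "\<exists>!x. x \<in> I \<and> X (Suc k) \<omega> = b \<and> ?H x \<omega>"
        unfolding \<omega>(2) simp_thms by (rule unique[OF \<omega>(1)])
    qed simp
  qed (fact finI joint_ev at[OF assms(3)])+
  also have "\<dots> = (\<Sum>x\<in>I. \<P>(\<omega> in M. ?H x \<omega>) * P (x k) b)"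
    by (rule sum.cong[OF HOL.refl joint])
  also have "\<dots> = (\<Sum>a\<in>S. \<Sum>x\<in>{x \<in> I. x k = a}. \<P>(\<omega> in M. ?H x \<omega>) * P (x k) b)"
    by (rule sum.group[symmetric]) (use finI assms(2) in \<open>auto simp: I_def PiE_iff\<close>)
  also have "\<dots> = (\<Sum>a\<in>S. \<P>(\<omega> in M. X k \<omega> = a) * P a b)"
    by (intro sum.cong) (simp_all add: now sum_distrib_right)
  finally show ?thesis .
qed

lemma (in prob_space) expectation_finite_range:
  fixes f :: "'s \<Rightarrow> real"
  assumes "Y \<in> measurable M (count_space S)" "finite S"
  shows "(\<integral>\<omega>. f (Y \<omega>) \<partial>M) = (\<Sum>b\<in>S. \<P>(\<omega> in M. Y \<omega> = b) * f b)"
proof -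
  note at = sets_value_eq[OF assms(1)]
  have "(\<integral>\<omega>. f (Y \<omega>) \<partial>M) = (\<integral>\<omega>. (\<Sum>b\<in>S. indicator {\<omega> \<in> space M. Y \<omega> = b} \<omega> * f b) \<partial>M)"
  proof (rule Bochner_Integration.integral_cong)
    fix \<omega> assume \<omega>: "\<omega> \<in> space M"
    then have "Y \<omega> \<in> S" using measurable_space[OF assms(1)] by simp
    then have "f (Y \<omega>) = (\<Sum>b\<in>S. if b = Y \<omega> then f b else 0)" using assms(2) by simp
    also have "\<dots> = (\<Sum>b\<in>S. indicator {\<omega> \<in> space M. Y \<omega> = b} \<omega> * f b)"
      using \<omega> by (intro sum.cong) auto
    finally show "f (Y \<omega>) = (\<Sum>b\<in>S. indicator {\<omega> \<in> space M. Y \<omega> = b} \<omega> * f b)" .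
  qed simp
  also have "\<dots> = (\<Sum>b\<in>S. \<integral>\<omega>. indicator {\<omega> \<in> space M. Y \<omega> = b} \<omega> * f b \<partial>M)"
    using at by (intro Bochner_Integration.integral_sum integrable_mult_left integrable_real_indicator)
      (auto simp: less_top[symmetric])
  also have "\<dots> = (\<Sum>b\<in>S. \<P>(\<omega> in M. Y \<omega> = b) * f b)"
    using at by (intro sum.cong) auto
  finally show ?thesis .
qed

section \<open>Limit distribution of the random walk\<close>

lemma sign_adj_transp [simp]: "sign (adj_transp i) = -1"
  by (simp add: adj_transp_def sign_swap_id)

lemma sign_comp_adj_transp:
  assumes "a permutes {1..n}"
  shows "sign (a \<circ> adj_transp i) = - sign a"
  using assms permutation_permutes[of a]
  by (subst sign_compose) (auto simp: adj_transp_def sign_swap_id permutation_swap_id)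

lemma sign_perm_of_word:
  assumes "js \<in> lists {1..<n}"
  shows "sign (perm_of_word n js) = (-1) ^ length js"
proof -
  from assms have "perm_of_word n js permutes {1..n} \<and> sign (perm_of_word n js) = (-1) ^ length js"
  proof (induction js)
    case Nil
    have "perm_of_word n [] = id" by (simp add: perm_of_word_def sym_group_one)
    then show ?case using permutes_id[of "{1..n}"] by (simp only: sign_id list.size power_0 simp_thms)
  next
    case (Cons i js)
    then have i: "i \<in> {1..<n}" and js: "perm_of_word n js permutes {1..n}" "sign (perm_of_word n js) = (-1) ^ length js"
      by auto
    note i = adj_transp_permutes[OF i]
    have "perm_of_word n (i # js) = adj_transp i \<circ> perm_of_word n js"
      by (simp add: perm_of_word_def sym_group_mult)
    moreover have "sign (adj_transp i \<circ> perm_of_word n js) = - sign (perm_of_word n js)"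
      using i js(1) by (subst sign_compose) (auto simp: permutation_permutes)
    ultimately show ?case
      using permutes_compose[OF js(1) i] js(2)
      by (simp only: list.size add_0_right add_Suc_right power_Suc mult_minus1 simp_thms)
  qed
  then show ?thesis by simp
qed

text \<open>
  The two-step kernel \<open>K\<close> on the even permutations has row sums \<open>1\<close> because \<open>P\<close> has column sums \<open>1\<close>,
  a positive diagonal because a step can be undone, and it is irreducible because an even
  permutation is a product of an even number of adjacent transpositions. Hence the distribution at
  even times converges to a constant on the even permutations, and the total mass \<open>1\<close> identifies it.
  The limit at odd times results from one further step.
\<close>

lemma random_walk_limit_distribution:
  assumes n: "n \<ge> 2"
    and ds: "doubly_stochastic_on (carrier (sym_group n)) P"
    and rw: "random_walk M n P X"
    and b: "b permutes {1..n}"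
  shows "(\<lambda>N. \<P>(\<omega> in M. X (2 * N) \<omega> = b)) \<longlonglongrightarrow> (1 + sign b) / fact n" (is ?even)
    and "(\<lambda>N. \<P>(\<omega> in M. X (2 * N + 1) \<omega> = b)) \<longlonglongrightarrow> (1 - sign b) / fact n" (is ?odd)
proof -
  define S where "S = {w :: nat \<Rightarrow> nat. w permutes {1..n}}"
  define A where "A = {w \<in> S. evenperm w}"
  define \<mu> where "\<mu> k w = \<P>(\<omega> in M. X k \<omega> = w)" for k w
  have carrier: "carrier (sym_group n) = S" by (simp add: sym_group_def S_def)
  have finS: "finite S" unfolding S_def by (intro finite_permutations) simp
  have finA: "finite A" "A \<subseteq> S" using finS by (auto simp: A_def)
  have chain: "markov_chain M S P X"
    using rw by (simp add: random_walk_def carrier)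
  interpret prob_space M using chain by (simp add: markov_chain_def)
  have nonneg: "0 \<le> P a c" if "a \<in> S" "c \<in> S" for a c
    using ds that by (simp add: doubly_stochastic_on_def carrier)
  have cols: "(\<Sum>a\<in>S. P a c) = 1" if "c \<in> S" for c
    using ds that by (simp add: doubly_stochastic_on_def carrier)
  have pos_iff: "P a c > 0 \<longleftrightarrow> (\<exists>i\<in>{1..<n}. c = a \<circ> adj_transp i)" if "a \<in> S" "c \<in> S" for a c
    using rw that by (simp add: random_walk_def carrier sym_group_mult)
  have stepS: "a \<circ> adj_transp i \<in> S" if "a \<in> S" "i \<in> {1..<n}" for a i
    using that permutes_compose[OF adj_transp_permutes[OF that(2)]] by (simp add: S_def)
  \<comment> \<open>A step of positive probability multiplies by a transposition, which ties parity to time.\<close>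
  have flip: "sign c = - sign a" if "a \<in> S" "c \<in> S" "P a c \<noteq> 0" for a c
    using pos_iff[OF that(1,2)] nonneg[OF that(1,2)] that sign_comp_adj_transp[of a n]
    by (auto simp: S_def)
  have step: "\<mu> (Suc k) c = (\<Sum>a\<in>S. \<mu> k a * P a c)" if "c \<in> S" for k c
    unfolding \<mu>_def by (rule markov_chain_step[OF chain finS that])
  have total: "(\<Sum>a\<in>S. \<mu> k a) = 1" for k
    using expectation_finite_range[of "X k" S "\<lambda>_. 1"] chain finS prob_space
    by (simp add: markov_chain_def \<mu>_def)
  have parity: "\<mu> k c = 0" if "c \<in> S" "sign c \<noteq> (-1) ^ k" for k c
    using that
  proof (induction k arbitrary: c)
    case 0
    have "AE \<omega> in M. X 0 \<omega> = id" using rw by (simp add: random_walk_def sym_group_one)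
    moreover have "c \<noteq> id" using 0 by auto
    ultimately have "AE \<omega> in M. X 0 \<omega> \<noteq> c" by (auto elim: eventually_mono)
    moreover have "{\<omega> \<in> space M. X 0 \<omega> = c} \<in> events"
      using chain 0(1) by (intro sets_value_eq) (auto simp: markov_chain_def)
    ultimately show ?case unfolding \<mu>_def by (simp add: prob_Collect_eq_0)
  next
    case (Suc k)
    have "\<mu> k a * P a c = 0" if a: "a \<in> S" for a
    proof (cases "P a c = 0")
      case False
      then have "sign a \<noteq> (-1) ^ k" using flip[OF a Suc.prems(1)] Suc.prems(2) by auto
      then show ?thesis using Suc.IH[OF a] by simp
    qed simp
    then show ?case unfolding step[OF Suc.prems(1)] by (intro sum.neutral ballI)
  qed
  have sgn: "sign a = (if a \<in> A then 1 else -1)" if "a \<in> S" for a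
    using that by (simp add: A_def sign_def)

  \<comment> \<open>The indices are reversed: \<open>K c a\<close> is the probability of going from \<open>a\<close> to \<open>c\<close> in two steps, since
    the averages are taken over the starting points.\<close>
  define K where "K c a = (\<Sum>d\<in>S. P a d * P d c)" for c a
  have K_nonneg: "0 \<le> K c a" if "a \<in> S" "c \<in> S" for a c
    unfolding K_def using nonneg that by (intro sum_nonneg mult_nonneg_nonneg)
  have K_pos: "K (a \<circ> adj_transp i \<circ> adj_transp j) a > 0"
    if a: "a \<in> S" and i: "i \<in> {1..<n}" and j: "j \<in> {1..<n}" for a i j
  proof -
    let ?d = "a \<circ> adj_transp i"
    let ?c = "?d \<circ> adj_transp j"
    have mem: "?d \<in> S" "?c \<in> S" using stepS[OF a i] stepS[OF stepS[OF a i] j] .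
    have "0 < P a ?d" "0 < P ?d ?c" using pos_iff[OF a mem(1)] pos_iff[OF mem] i j by blast+
    then have "0 < P a ?d * P ?d ?c" by simp
    also have "\<dots> \<le> K ?c a"
      unfolding K_def using nonneg a mem finS
      by (intro member_le_sum[where f = "\<lambda>d. P a d * P d ?c"]) (auto simp del: comp_apply)
    finally show ?thesis .
  qed
  have K_odd: "K c a = 0" if "c \<in> A" "a \<in> S" "a \<notin> A" for a c
  proof -
    have "P a d * P d c = 0" if d: "d \<in> S" for d
    proof (rule ccontr)
      assume "P a d * P d c \<noteq> 0"
      then have "sign c = sign a"
        using flip[of a d] flip[of d c] d \<open>a \<in> S\<close> \<open>c \<in> A\<close> finA(2) by auto
      then show False using sgn[of a] sgn[of c] that \<open>c \<in> A\<close> \<open>a \<in> S\<close> \<open>a \<notin> A\<close> finA(2) by auto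
    qed
    then show ?thesis unfolding K_def by (intro sum.neutral ballI)
  qed
  have restrict_A: "(\<Sum>a\<in>A. g a) = (\<Sum>a\<in>S. g a)" if "\<And>a. a \<in> S \<Longrightarrow> a \<notin> A \<Longrightarrow> g a = 0"
    for g :: "(nat \<Rightarrow> nat) \<Rightarrow> real"
    using finS finA(2) that by (intro sum.mono_neutral_left) auto
  have idA: "id \<in> A" using permutes_id[of "{1..n}"] by (simp only: A_def S_def mem_Collect_eq evenperm_id simp_thms)

  obtain l where l: "\<And>a. a \<in> A \<Longrightarrow> (\<lambda>N. \<mu> (2 * N) a) \<longlonglongrightarrow> l"
  proof (rule irreducible_averaging_converges[where A = A and K = K and v = "\<lambda>N. \<mu> (2 * N)"])
    show "A \<noteq> {}" using idA by blast
    show "0 \<le> K c a" if "a \<in> A" "c \<in> A" for a c using K_nonneg that finA(2) by blast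
    show "(\<Sum>a\<in>A. K c a) = 1" if c: "c \<in> A" for c
    proof -
      have "(\<Sum>a\<in>A. K c a) = (\<Sum>a\<in>S. \<Sum>d\<in>S. P a d * P d c)"
        using restrict_A[of "K c"] K_odd[OF c] by (simp add: K_def)
      also have "\<dots> = (\<Sum>d\<in>S. (\<Sum>a\<in>S. P a d) * P d c)"
        by (subst sum.swap) (simp add: sum_distrib_right)
      also have "\<dots> = 1" using c cols finA(2) by (auto simp: subset_iff)
      finally show ?thesis .
    qed
    show "0 < K a a" if "a \<in> A" for a
    proof -
      have "a \<circ> adj_transp 1 \<circ> adj_transp 1 = a" by (simp add: fun_eq_iff adj_transp_def)
      then show ?thesis using K_pos[of a 1 1] n that finA(2) by auto
    qed
    show "\<mu> (2 * Suc N) c = (\<Sum>a\<in>A. K c a * \<mu> (2 * N) a)" if c: "c \<in> A" for N c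
    proof -
      have cS: "c \<in> S" using c finA(2) by blast
      have "\<mu> (2 * Suc N) c = (\<Sum>d\<in>S. \<mu> (Suc (2 * N)) d * P d c)" using step[OF cS] by simp
      also have "\<dots> = (\<Sum>d\<in>S. \<Sum>a\<in>S. \<mu> (2 * N) a * P a d * P d c)"
        by (simp add: step sum_distrib_right)
      also have "\<dots> = (\<Sum>a\<in>S. K c a * \<mu> (2 * N) a)"
        by (subst sum.swap) (simp add: K_def sum_distrib_left sum_distrib_right mult_ac)
      also have "\<dots> = (\<Sum>a\<in>A. K c a * \<mu> (2 * N) a)"
        using K_odd[OF c] by (intro restrict_A[symmetric]) simp
      finally show ?thesis .
    qed
    let ?R = "{(x, y). x \<in> A \<and> y \<in> A \<and> 0 < K y x}"
    have walk: "(a, a \<circ> perm_of_word n js) \<in> ?R\<^sup>*"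
      if "a \<in> A" "js \<in> lists {1..<n}" "length js = 2 * m" for a js m
      using that
    proof (induction m arbitrary: a js)
      case 0
      then show ?case by (simp add: perm_of_word_def sym_group_one)
    next
      case (Suc m)
      then obtain i j ks where js: "js = i # j # ks"
        by (metis length_Suc_conv mult_Suc_right add_2_eq_Suc)
      let ?c = "a \<circ> adj_transp i \<circ> adj_transp j"
      have ij: "i \<in> {1..<n}" "j \<in> {1..<n}" and ks: "ks \<in> lists {1..<n}" "length ks = 2 * m"
        using Suc.prems js by auto
      have aS: "a \<in> S" using Suc.prems(1) finA(2) by blast
      have cS: "?c \<in> S" using stepS[OF stepS[OF aS ij(1)] ij(2)] .
      have "sign ?c = sign a"
        using sign_comp_adj_transp[of a n i] sign_comp_adj_transp[of "a \<circ> adj_transp i" n j]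
          aS stepS[OF aS ij(1)] by (simp add: S_def)
      then have "?c \<in> A" using sgn[OF aS] sgn[OF cS] Suc.prems(1) by (auto split: if_splits)
      moreover have "0 < K ?c a" using K_pos[OF aS ij] .
      ultimately have "(a, ?c) \<in> ?R" using Suc.prems(1) by simp
      then have "(a, ?c \<circ> perm_of_word n ks) \<in> ?R\<^sup>*"
        using Suc.IH[OF \<open>?c \<in> A\<close> ks] by (rule converse_rtrancl_into_rtrancl)
      moreover have "?c \<circ> perm_of_word n ks = a \<circ> perm_of_word n js"
        by (simp add: js perm_of_word_def sym_group_mult comp_assoc)
      ultimately show ?case by (simp only:)
    qed
    show "(a, c) \<in> ?R\<^sup>*" if a: "a \<in> A" and c: "c \<in> A" for a c
    proof -
      have perms: "a permutes {1..n}" "c permutes {1..n}" using a c by (auto simp: A_def S_def)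
      obtain js where js: "js \<in> lists {1..<n}" "perm_of_word n js = inv' a \<circ> c"
        using perm_of_word_surj[OF permutes_compose[OF perms(2) permutes_inv[OF perms(1)]]] .
      have "(-1) ^ length js = sign (inv' a \<circ> c)" using sign_perm_of_word[OF js(1)] js(2) by simp
      also have "\<dots> = 1"
      proof -
        have "permutation a" "permutation c" using perms permutation_permutes by blast+
        then show ?thesis
          using sgn[of a] sgn[of c] a c subsetD[OF finA(2)]
          by (simp add: sign_compose permutation_inverse sign_inverse)
      qed
      finally have "even (length js)"
        by (metis neg_one_odd_power one_neq_neg_one)
      then obtain m where "length js = 2 * m" by blast
      from walk[OF a js(1) this] show ?thesis
        using js(2) permutes_inv_o(1)[OF perms(1)] by (simp add: o_assoc)
    qed
  qed (use finA in auto)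
  have "(\<lambda>N. \<Sum>a\<in>A. \<mu> (2 * N) a) \<longlonglongrightarrow> (\<Sum>a\<in>A. l)" by (intro tendsto_sum l)
  moreover have "(\<Sum>a\<in>A. \<mu> (2 * N) a) = 1" for N
    unfolding total[of "2 * N", symmetric]
    by (intro restrict_A parity) (auto simp: sgn)
  ultimately have mass: "real (card A) * l = 1" by (simp add: LIMSEQ_const_iff)
  have "2 * card A = fact n"
    using alt_group_card_carrier[of n] n
    by (simp add: alt_group_def A_def S_def fact_reduce)
  then have "fact n = 2 * real (card A)" by (metis of_nat_fact of_nat_mult of_nat_numeral)
  then have "fact n * l = 2" using mass by (simp only: mult.assoc mult_1_right)
  then have l_eq: "l = 2 / fact n" by (simp add: field_simps)
  have even: "(\<lambda>N. \<mu> (2 * N) c) \<longlonglongrightarrow> (1 + sign c) / fact n" if "c \<in> S" for c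
  proof (cases "c \<in> A")
    case True
    then show ?thesis using l[OF True] sgn[OF that] by (simp add: l_eq)
  next
    case False
    then show ?thesis using parity[OF that] sgn[OF that] by simp
  qed
  have bS: "b \<in> S" using b by (simp add: S_def)
  show ?even using even[OF bS] by (simp add: \<mu>_def)
  have "(\<lambda>N. \<Sum>a\<in>S. \<mu> (2 * N) a * P a b) \<longlonglongrightarrow> (\<Sum>a\<in>S. (1 + sign a) / fact n * P a b)"
    by (intro tendsto_sum tendsto_mult_right even)
  moreover have "(\<Sum>a\<in>S. (1 + sign a) / fact n * P a b) = (\<Sum>a\<in>S. (1 - sign b) / fact n * P a b)"
  proof (rule sum.cong[OF HOL.refl])
    fix a assume "a \<in> S"
    then show "(1 + sign a) / fact n * P a b = (1 - sign b) / fact n * P a b"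
      using flip[OF _ bS, of a] by (cases "P a b = 0") simp_all
  qed
  moreover have "(\<Sum>a\<in>S. (1 - sign b) / fact n * P a b) = (1 - sign b) / fact n"
    by (simp only: sum_distrib_left[symmetric] cols[OF bS] mult_1_right)
  ultimately have "(\<lambda>N. \<mu> (2 * N + 1) b) \<longlonglongrightarrow> (1 - sign b) / fact n"
    by (simp only: Suc_eq_plus1[symmetric] step[OF bS])
  then show ?odd by (simp only: \<mu>_def)
qed

section \<open>Expected number of components\<close>

theorem proposition4p2:
  fixes n :: nat
    and M :: "'a measure"
    and P :: "(nat \<Rightarrow> nat) \<Rightarrow> (nat \<Rightarrow> nat) \<Rightarrow> real"
    and X :: "nat \<Rightarrow> 'a \<Rightarrow> (nat \<Rightarrow> nat)"
  assumes "n \<ge> 2"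
    and "doubly_stochastic_on (carrier (sym_group n)) P"
    and "random_walk M n P X"
  shows "(\<lambda>N. \<integral>\<omega>. real (num_components (braid_closure n (braid_lift n (X (2 * N) \<omega>)))) \<partial>M)
           \<longlonglongrightarrow> harm n + (-1) ^ n / (real n * (real n - 1))
       \<and> (\<lambda>N. \<integral>\<omega>. real (num_components (braid_closure n (braid_lift n (X (2 * N + 1) \<omega>)))) \<partial>M)
           \<longlonglongrightarrow> harm n - (-1) ^ n / (real n * (real n - 1))"
proof -
  let ?S = "{w. w permutes {1..n}}"
  let ?c = "\<lambda>w. real (num_components (braid_closure n (braid_lift n w)))"
  have carrier: "carrier (sym_group n) = ?S" by (simp add: sym_group_def)
  have chain: "markov_chain M ?S P X" using assms(3) by (simp add: random_walk_def carrier)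
  interpret prob_space M using chain by (simp add: markov_chain_def)
  have expectation: "(\<integral>\<omega>. ?c (X k \<omega>) \<partial>M)
      = (\<Sum>w\<in>?S. \<P>(\<omega> in M. X k \<omega> = w) * real (num_cycles {1..n} w))" for k
  proof -
    have "(\<integral>\<omega>. ?c (X k \<omega>) \<partial>M) = (\<Sum>w\<in>?S. \<P>(\<omega> in M. X k \<omega> = w) * ?c w)"
      using chain by (intro expectation_finite_range)
        (auto simp: markov_chain_def finite_permutations)
    also have "\<dots> = (\<Sum>w\<in>?S. \<P>(\<omega> in M. X k \<omega> = w) * real (num_cycles {1..n} w))"
      by (intro sum.cong) (simp_all add: num_components_closure_lift)
    finally show ?thesis .
  qed
  note lim = random_walk_limit_distribution[OF assms]
  have "(\<lambda>N. \<integral>\<omega>. ?c (X (2 * N) \<omega>) \<partial>M) \<longlonglongrightarrow>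
      (\<Sum>w\<in>?S. (1 + 1 * real_of_int (sign w)) / fact n * real (num_cycles {1..n} w))"
    unfolding expectation by (intro tendsto_sum tendsto_mult_right) (use lim(1) in simp)
  moreover have "(\<lambda>N. \<integral>\<omega>. ?c (X (2 * N + 1) \<omega>) \<partial>M) \<longlonglongrightarrow>
      (\<Sum>w\<in>?S. (1 + (-1) * real_of_int (sign w)) / fact n * real (num_cycles {1..n} w))"
    unfolding expectation by (intro tendsto_sum tendsto_mult_right) (use lim(2) in simp)
  ultimately show ?thesis
    unfolding mean_num_cycles_fixed_parity[OF assms(1)] by simp
qed

end
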